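(* Let $P$ be a finite non-empty poset and let $d \geq 2$ be an integer. Then, for every $i \geq 0$, $$\beta_i(H_{P,d})=\sum_{\alpha \in \mathbb{I}(P)} \left[\sum_{h=0}^{|\mathrm{Max}(\alpha)|}\binom{|\mathrm{Max}(\alpha)|}{h}\beta_{i-h}(H_{\alpha,d-1}) \right].$$
   Context: Let $\mathbb{k}$ be a field. Let $P=\{p_1,\dots,p_n\}$ be a finite poset labelled so that $p_i<p_j$ implies $i<j$. A poset ideal of $P$ is a subset $\alpha\subseteq P$ such that $p\in\alpha$, $q\in P$, $q\le p$ imply $q\in\alpha$; $\mathbb{I}(P)$ is the set of all poset ideals of $P$ (including $\emptyset$ and $P$). Each subset $\alpha \subseteq P$ is regarded as a poset with the induced order (its elements keeping their labels), and $\mathrm{Max}(\alpha)$ is the set of maximal elements of $\alpha$ (so $\mathrm{Max}(\emptyset)=\emptyset$). $|\cdot|$ denotes cardinality. Let $Q\subseteq P$ be a subposet and $e\ge 1$ an integer. A multichain of length $e$ in $Q$ is a sequence $p_{j_1}\le p_{j_2}\le\cdots\le p_{j_e}$ of elements of $Q$ (repetitions allowed). The clutter $\mathcal{C}_{Q,e}$ has vertex set $\{x_{rj}: 1\le r\le e,\ p_j\in Q\}$ and edges $\{x_{1j_1},x_{2j_2},\dots,x_{ej_e}\}$, one for each multichain $p_{j_1}\le\cdots\le p_{j_e}$ of length $e$ in $Q$. A vertex cover is a set of vertices meeting every edge. $H_{Q,e}$ denotes the cover ideal of $\mathcal{C}_{Q,e}$ (the Alexander dual $I(\mathcal{C}_{Q,e})^*$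 of its edge ideal): the ideal generated by the monomials $\prod_{x\in W}x$ with $W$ a vertex cover of $\mathcal{C}_{Q,e}$, in the polynomial ring over $\mathbb{k}$ in the vertices (or in any larger polynomial ring; this does not affect Betti numbers). For $Q=\emptyset$ this is the unit ideal, $H_{\emptyset,e}=(1)$, with $\beta_0=1$ and $\beta_i=0$ for $i\ne 0$. For a monomial ideal $I$ in a polynomial ring over $\mathbb{k}$, $\beta_i(I)=\dim_{\mathbb{k}}\mathrm{Tor}_i(I,\mathbb{k})$ is the $i$-th total Betti number of $I$ over that ring, with $\beta_i(I)=0$ for $i<0$. *)

theory Defs
  imports
    "HOL-Library.Poly_Mapping"
    "Jordan_Normal_Form.Matrix_Kernel"
    "Jordan_Normal_Form.DL_Rank"
begin

text \<open>A monomial is its finitely supported exponent function, and a polynomial is a finitely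
  supported function from monomials to coefficients.  All elements of the type \<open>'v\<close> are variables.\<close>

type_synonym ('v, 'k) mpoly = "('v \<Rightarrow>\<^sub>0 nat) \<Rightarrow>\<^sub>0 'k"

definition var :: "'v \<Rightarrow> ('v, 'k::comm_ring_1) mpoly" where
  "var x = Poly_Mapping.single (Poly_Mapping.single x 1) 1"

definition ideal_gen :: "'r::comm_ring_1 set \<Rightarrow> 'r set" where
  "ideal_gen G = Modules.module.span (*) G"

text \<open>The residue class map \<open>S \<rightarrow> S / (variables) = k\<close>.\<close>

definition residue :: "('v, 'k::comm_ring_1) mpoly \<Rightarrow> 'k" where
  "residue f = Poly_Mapping.lookup f 0"

definition mat_range :: "'r::comm_ring_1 mat \<Rightarrow> 'r vec set" where
  "mat_range A = (\<lambda>v. A *\<^sub>v v) ` carrier_vec (dim_col A)"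

text \<open>A resolution
  \<open>\<cdots> \<rightarrow> F\<^sub>2 \<rightarrow> F\<^sub>1 \<rightarrow> F\<^sub>0 \<rightarrow> I \<rightarrow> 0\<close> of an ideal \<open>I\<close> of \<open>S\<close> by free
  modules of finite rank: \<open>F\<^sub>i\<close> is \<open>S^r\<close> with \<open>r = dim_col (\<phi> i)\<close>, the matrix \<open>\<phi> (i + 1)\<close>
  is the map from \<open>F\<close> in degree \<open>i + 1\<close> to \<open>F\<^sub>i\<close>, and \<open>\<phi> 0\<close> is the augmentation
  from \<open>F\<^sub>0\<close> onto \<open>I\<close>, which is a submodule of \<open>S = S^1\<close>.  The resolution need not be
  minimal, graded or of finite length.\<close>

definition free_resolution :: "'r::comm_ring_1 set \<Rightarrow> (nat \<Rightarrow> 'r mat) \<Rightarrow> bool" where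
  "free_resolution I \<phi> \<longleftrightarrow>
     dim_row (\<phi> 0) = 1 \<and>
     (\<forall>i. dim_row (\<phi> (Suc i)) = dim_col (\<phi> i)) \<and>
     mat_range (\<phi> 0) = {v \<in> carrier_vec 1. v $ 0 \<in> I} \<and>
     (\<forall>i. mat_range (\<phi> (Suc i)) = mat_kernel (\<phi> i))"

text \<open>The differential leaving degree \<open>i\<close> of the complex \<open>F \<otimes>\<^sub>S k\<close>, where
  \<open>S^r \<otimes>\<^sub>S k\<close> is identified with \<open>k^r\<close>.  The augmentation is dropped, so the
  differential leaving degree \<open>0\<close> is the map to the zero space.\<close>

definition tensor_diff :: "(nat \<Rightarrow> ('v, 'k::field) mpoly mat) \<Rightarrow> nat \<Rightarrow> 'k mat" where
  "tensor_diff \<phi> i =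
     (if i = 0 then 0\<^sub>m 0 (dim_col (\<phi> 0)) else map_mat residue (\<phi> i))"

text \<open>The dimension of \<open>H\<^sub>i(F \<otimes>\<^sub>S k)\<close>, that is, of the kernel of the outgoing differential
  modulo the range of the incoming one.  The range is contained in the kernel, so that the
  subtraction does not truncate.\<close>

definition homology_dim :: "(nat \<Rightarrow> ('v, 'k::field) mpoly mat) \<Rightarrow> nat \<Rightarrow> nat" where
  "homology_dim \<phi> i =
     kernel_dim (tensor_diff \<phi> i) - vec_space.rank (dim_col (\<phi> i)) (tensor_diff \<phi> (Suc i))"

text \<open>The dimension of \<open>Tor\<^sub>i(I, k)\<close>, computed from a chosen free resolution of \<open>I\<close>.  Every
  finitely generated monomial ideal has a resolution of the above kind.\<close>

definition betti :: "('v, 'k::field) mpoly set \<Rightarrow> int \<Rightarrow> nat" where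
  "betti I i = (if i < 0 then 0 else homology_dim (SOME \<phi>. free_resolution I \<phi>) (nat i))"

definition vertex_cover :: "'v set \<Rightarrow> 'v set set \<Rightarrow> 'v set \<Rightarrow> bool" where
  "vertex_cover V E W \<longleftrightarrow> W \<subseteq> V \<and> (\<forall>A\<in>E. W \<inter> A \<noteq> {})"

definition cover_ideal :: "'v set \<Rightarrow> 'v set set \<Rightarrow> ('v, 'k::field) mpoly set" where
  "cover_ideal V E = ideal_gen {\<Prod>x\<in>W. var x | W. vertex_cover V E W}"

definition poset_ideals :: "'a::order set \<Rightarrow> 'a set set" where
  "poset_ideals P = {\<alpha>. \<alpha> \<subseteq> P \<and> (\<forall>a\<in>\<alpha>. \<forall>q\<in>P. q \<le> a \<longrightarrow> q \<in> \<alpha>)}"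

definition max_elements :: "'a::order set \<Rightarrow> 'a set" where
  "max_elements \<alpha> = {m \<in> \<alpha>. \<forall>q\<in>\<alpha>. \<not> m < q}"

text \<open>The elements of the ambient poset are \<open>p 1, \<dots>, p n\<close>; \<open>Q\<close> is a subset of it.  The vertex
  \<open>x\<^sub>r\<^sub>j\<close> is the pair \<open>(r, j)\<close>.\<close>

definition labels :: "(nat \<Rightarrow> 'a) \<Rightarrow> nat \<Rightarrow> 'a set \<Rightarrow> nat set" where
  "labels p n Q = {j \<in> {1..n}. p j \<in> Q}"

text \<open>A multichain of length \<open>e\<close> in \<open>Q\<close>, given by its sequence of labels
  \<open>j 1, \<dots>, j e\<close>.\<close>

definition multichain :: "(nat \<Rightarrow> 'a::order) \<Rightarrow> nat \<Rightarrow> 'a set \<Rightarrow> nat \<Rightarrow> (nat \<Rightarrow> nat) \<Rightarrow> bool" where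
  "multichain p n Q e j \<longleftrightarrow>
     (\<forall>r\<in>{1..e}. j r \<in> labels p n Q) \<and>
     (\<forall>r\<in>{1..<e}. p (j r) \<le> p (j (Suc r)))"

definition clutter_vertices :: "(nat \<Rightarrow> 'a) \<Rightarrow> nat \<Rightarrow> 'a set \<Rightarrow> nat \<Rightarrow> (nat \<times> nat) set" where
  "clutter_vertices p n Q e = {1..e} \<times> labels p n Q"

definition clutter_edges :: "(nat \<Rightarrow> 'a::order) \<Rightarrow> nat \<Rightarrow> 'a set \<Rightarrow> nat \<Rightarrow> (nat \<times> nat) set set" where
  "clutter_edges p n Q e = {(\<lambda>r. (r, j r)) ` {1..e} | j. multichain p n Q e j}"

text \<open>All ideals \<open>H\<close> are taken in the same polynomial ring, whose variables are the
  \<open>x\<^sub>r\<^sub>j\<close> for all natural numbers \<open>r\<close> and \<open>j\<close>.  Since it is a polynomial ring over, hence flat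
  over, the one in the vertices only, the Betti numbers are the same.\<close>

definition multichain_cover_ideal ::
  "(nat \<Rightarrow> 'a::order) \<Rightarrow> nat \<Rightarrow> 'a set \<Rightarrow> nat \<Rightarrow> (nat \<times> nat, 'k::field) mpoly set" where
  "multichain_cover_ideal p n Q e =
     cover_ideal (clutter_vertices p n Q e) (clutter_edges p n Q e)"

end

theory Submission
  imports Defs
begin

text \<open>The ideal of the multichain clutter of \<open>Q\<close> is generated by the squarefree monomials
  \<open>u\<^sub>f = \<Prod>x\<^bsub>f(j) j\<^esub>\<close>, where \<open>f\<close> runs over the isotone maps from \<open>Q\<close> to \<open>{1..e}\<close>: such a
  graph meets every multichain because \<open>r \<mapsto> f (j\<^sub>r)\<close> is a monotone self-map of \<open>{1..e}\<close> and so has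
  a fixed point.  Adding these generators one at a time, larger maps first, gives linear quotients:
  the colon ideal at \<open>f\<close> is generated by the variables \<open>x\<^bsub>r+1, j\<^esub>\<close> with \<open>1 \<le> r < e\<close> and \<open>p\<^sub>j\<close>
  maximal in \<open>{f \<le> r}\<close>, since these are the single values of \<open>f\<close> that can be raised.  Iterated
  mapping cones then give a linear resolution, which is minimal, so that
  \<open>\<beta>\<^sub>i = \<Sum>f. s(f) choose i\<close> with \<open>s(f)\<close> the number of these variables, that is,
  \<open>s(f) = \<Sum>r<e. card Max {f \<le> r}\<close>.
  An isotone map from \<open>P\<close> to \<open>{1..d}\<close> is the same as the poset ideal \<open>\<alpha> = {f \<le> d - 1}\<close> together
  with an isotone map \<open>g\<close> from \<open>\<alpha>\<close> to \<open>{1..d - 1}\<close>, and \<open>s(f) = card Max \<alpha> + s(g)\<close>;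
  Vandermonde's identity finishes the proof.\<close>

section \<open>Comparison of free resolutions\<close>

lemma assoc_mult_mat_dim:
  fixes A :: "'r::comm_ring_1 mat"
  assumes "dim_col A = dim_row B" "dim_col B = dim_row C"
  shows "A * B * C = A * (B * C)"
  using assms by (intro assoc_mult_mat) auto

lemma mult_mat_unit_vec:
  fixes A :: "'r::comm_ring_1 mat"
  assumes "A \<in> carrier_mat n m" "j < m"
  shows "A *\<^sub>v unit_vec m j = col A j"
  using col_mult2[of A n m "1\<^sub>m m" m j] assms by simp

lemma zero_mat_mult_vec:
  fixes v :: "'r::comm_ring_1 vec"
  assumes "v \<in> carrier_vec m"
  shows "0\<^sub>m n m *\<^sub>v v = 0\<^sub>v n"
  using assms by (intro eq_vecI) auto

lemma mat_eqI_mult_vec: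
  fixes A :: "'r::comm_ring_1 mat"
  assumes "A \<in> carrier_mat n m" "B \<in> carrier_mat n m"
    and "\<And>v. v \<in> carrier_vec m \<Longrightarrow> A *\<^sub>v v = B *\<^sub>v v"
  shows "A = B"
proof (rule eq_matI)
  fix i j assume ij: "i < dim_row B" "j < dim_col B"
  have "A *\<^sub>v unit_vec m j = B *\<^sub>v unit_vec m j" using assms(3)[of "unit_vec m j"] by simp
  then have "col A j = col B j" using ij assms(1,2) mult_mat_unit_vec[OF assms(1), of j] mult_mat_unit_vec[OF assms(2), of j] by simp
  then show "A $$ (i, j) = B $$ (i, j)" using ij assms(1,2) by (metis carrier_matD index_col)
qed (use assms in auto)

text \<open>Free modules are projective: a preimage of each column of \<open>B\<close> is chosen,
  and the chosen vectors become the columns of \<open>X\<close>.\<close>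

lemma mat_range_factor:
  fixes A :: "'r::comm_ring_1 mat"
  assumes A: "A \<in> carrier_mat n m" and B: "B \<in> carrier_mat n c"
    and sub: "\<And>j. j < c \<Longrightarrow> col B j \<in> mat_range A"
  shows "\<exists>X\<in>carrier_mat m c. A * X = B"
proof -
  have "\<forall>j\<in>{..<c}. \<exists>x. x \<in> carrier_vec m \<and> A *\<^sub>v x = col B j"
    using sub A unfolding mat_range_def by force
  then obtain x where x: "\<And>j. j < c \<Longrightarrow> x j \<in> carrier_vec m \<and> A *\<^sub>v x j = col B j"
    by (metis lessThan_iff)
  define X where "X = mat_of_cols m (map x [0..<c])"
  have X: "X \<in> carrier_mat m c" unfolding X_def by (rule carrier_matI) auto
  have "A * X = B"
  proof (rule mat_col_eqI)
    fix j assume j: "j < dim_col B"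
    then have j: "j < c" using B by simp
    have "col X j = x j" unfolding X_def using j x by (subst col_mat_of_cols) auto
    then show "col (A * X) j = col B j" using A X j x by (subst col_mult2) auto
  qed (use A B X in auto)
  with X show ?thesis by blast
qed

lemma mult_mat_eq_zero_iff:
  fixes A :: "'r::comm_ring_1 mat"
  assumes A: "A \<in> carrier_mat n m" and B: "B \<in> carrier_mat m c"
  shows "A * B = 0\<^sub>m n c \<longleftrightarrow> (\<forall>v\<in>carrier_vec c. A *\<^sub>v (B *\<^sub>v v) = 0\<^sub>v n)"
proof
  assume "A * B = 0\<^sub>m n c"
  then show "\<forall>v\<in>carrier_vec c. A *\<^sub>v (B *\<^sub>v v) = 0\<^sub>v n"
    using A B by (metis assoc_mult_mat_vec zero_mat_mult_vec)
next
  assume "\<forall>v\<in>carrier_vec c. A *\<^sub>v (B *\<^sub>v v) = 0\<^sub>v n"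
  then show "A * B = 0\<^sub>m n c"
    using A B by (intro mat_eqI_mult_vec[of _ n c]) (auto simp: zero_mat_mult_vec)
qed

section \<open>Resolutions with named ranks, and lifting along them\<close>

text \<open>The ranks are named by \<open>a\<close>, so that all carrier conditions can be stated in
  terms of \<open>a\<close> and Betti numbers can later be read off from it.\<close>

definition ranked_resolution :: "'r::comm_ring_1 set \<Rightarrow> (nat \<Rightarrow> nat) \<Rightarrow> (nat \<Rightarrow> 'r mat) \<Rightarrow> bool" where
  "ranked_resolution I a \<phi> \<longleftrightarrow> free_resolution I \<phi> \<and> (\<forall>i. dim_col (\<phi> i) = a i)"

lemma ranked_resolution_carrier:
  assumes "ranked_resolution I a \<phi>"
  shows "\<phi> 0 \<in> carrier_mat 1 (a 0)" and "\<phi> (Suc i) \<in> carrier_mat (a i) (a (Suc i))"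
    and "\<phi> i \<in> carrier_mat (dim_row (\<phi> i)) (a i)"
  using assms unfolding ranked_resolution_def free_resolution_def by auto

lemma ranked_resolution_range:
  assumes "ranked_resolution I a \<phi>"
  shows "mat_range (\<phi> 0) = {v \<in> carrier_vec 1. v $ 0 \<in> I}"
    and "mat_range (\<phi> (Suc i)) = mat_kernel (\<phi> i)"
  using assms unfolding ranked_resolution_def free_resolution_def by auto

lemma ranked_resolution_complex:
  assumes "ranked_resolution I a \<phi>"
  shows "\<phi> i * \<phi> (Suc i) = 0\<^sub>m (dim_row (\<phi> i)) (a (Suc i))"
proof -
  note c = ranked_resolution_carrier[OF assms]
  have "\<phi> (Suc i) *\<^sub>v v \<in> mat_kernel (\<phi> i)" if "v \<in> carrier_vec (a (Suc i))" for v
    using c(2)[of i] ranked_resolution_range(2)[OF assms, of i] that unfolding mat_range_def by auto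
  then show ?thesis
    by (subst mult_mat_eq_zero_iff[OF c(3) c(2)]) (auto simp: mat_kernel_def)
qed

text \<open>Exactness in matrix form. The columns of \<open>B\<close> are cycles, hence boundaries,
  so \<open>B\<close> lifts along the next differential; the inductive constructions of chain maps
  and homotopies rest on this step.\<close>

lemma ranked_resolution_lift:
  assumes res: "ranked_resolution I a \<phi>" and B: "B \<in> carrier_mat (a i) c"
    and zero: "\<phi> i * B = 0\<^sub>m (dim_row (\<phi> i)) c"
  shows "\<exists>X\<in>carrier_mat (a (Suc i)) c. \<phi> (Suc i) * X = B"
proof (rule mat_range_factor[OF ranked_resolution_carrier(2)[OF res] B])
  fix j assume j: "j < c"
  have "\<phi> i *\<^sub>v col B j = col (\<phi> i * B) j"
    using col_mult2[OF ranked_resolution_carrier(3)[OF res] B j] by simp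
  then have "col B j \<in> mat_kernel (\<phi> i)"
    using B j carrier_matD(2)[OF ranked_resolution_carrier(3)[OF res, of i]]
    by (simp add: mat_kernel_def zero)
  then show "col B j \<in> mat_range (\<phi> (Suc i))" by (simp add: ranked_resolution_range(2)[OF res])
qed

text \<open>The bottom case of lifting: at the augmentation, being a cycle is replaced by membership
  in \<open>I\<close>, onto which \<open>\<phi> 0\<close> is surjective.\<close>

lemma ranked_resolution_lift0:
  assumes res: "ranked_resolution I a \<phi>" and B: "B \<in> carrier_mat 1 c"
    and mem: "\<And>j. j < c \<Longrightarrow> B $$ (0, j) \<in> I"
  shows "\<exists>X\<in>carrier_mat (a 0) c. \<phi> 0 * X = B"
proof (rule mat_range_factor[OF ranked_resolution_carrier(1)[OF res] B])
  fix j assume "j < c"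
  then show "col B j \<in> mat_range (\<phi> 0)"
    using B mem[of j] by (auto simp: ranked_resolution_range(1)[OF res] intro: carrier_vecI)
qed

lemma ranked_resolution_entry0:
  assumes res: "ranked_resolution I a \<phi>" and j: "j < a 0"
  shows "\<phi> 0 $$ (0, j) \<in> I"
proof -
  note c = ranked_resolution_carrier(1)[OF res]
  have "\<phi> 0 *\<^sub>v unit_vec (a 0) j \<in> mat_range (\<phi> 0)"
    using c unfolding mat_range_def by auto
  then show ?thesis
    using c j by (simp add: ranked_resolution_range(1)[OF res] mult_mat_unit_vec[OF c j])
qed

text \<open>The comparison theorem for the identity of \<open>I\<close>: a chain map is built degree
  by degree, each time lifting along the exact complex \<open>\<psi>\<close>.\<close>

lemma comparison_map:
  assumes F: "ranked_resolution I a \<phi>" and G: "ranked_resolution I b \<psi>"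
  obtains f where
    "\<And>i. f i \<in> carrier_mat (b i) (a i)"
    "\<psi> 0 * f 0 = \<phi> 0"
    "\<And>i. \<psi> (Suc i) * f (Suc i) = f i * \<phi> (Suc i)"
proof -
  \<comment> \<open>The invariant carries the fact needed to continue:
    \<open>X * \<phi> (Suc i)\<close> is a cycle of \<open>\<psi>\<close>, so it lifts to degree
    \<open>Suc i\<close>. The last conjunct fixes the start over the identity of
    \<open>I\<close>.\<close>
  let ?P = "\<lambda>i X. X \<in> carrier_mat (b i) (a i) \<and>
    \<psi> i * (X * \<phi> (Suc i)) = 0\<^sub>m (dim_row (\<psi> i)) (a (Suc i)) \<and>
    (i = 0 \<longrightarrow> \<psi> 0 * X = \<phi> 0)"
  note Fc = ranked_resolution_carrier(1,2)[OF F] and Gc = ranked_resolution_carrier(1,2)[OF G]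
  note FF = ranked_resolution_complex[OF F]
  have "\<exists>f. \<forall>i. ?P i (f i) \<and> \<psi> (Suc i) * f (Suc i) = f i * \<phi> (Suc i)"
  proof (rule dependent_nat_choice)
    obtain X where X: "X \<in> carrier_mat (b 0) (a 0)" "\<psi> 0 * X = \<phi> 0"
      using ranked_resolution_lift0[OF G Fc(1)] ranked_resolution_entry0[OF F] by blast
    moreover have "\<psi> 0 * (X * \<phi> (Suc 0)) = \<psi> 0 * X * \<phi> (Suc 0)"
      using X(1) Fc(2)[of 0] Gc(1) by (intro assoc_mult_mat_dim[symmetric]) auto
    ultimately show "\<exists>X. ?P 0 X"
      using FF[of 0] Fc(1) Gc(1) by auto
  next
    fix X i assume X: "?P i X"
    have XF: "X * \<phi> (Suc i) \<in> carrier_mat (b i) (a (Suc i))"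
      using X Fc(2)[of i] by auto
    obtain Y where Y: "Y \<in> carrier_mat (b (Suc i)) (a (Suc i))"
      "\<psi> (Suc i) * Y = X * \<phi> (Suc i)"
      using ranked_resolution_lift[OF G XF] X by blast
    have "\<psi> (Suc i) * (Y * \<phi> (Suc (Suc i))) = \<psi> (Suc i) * Y * \<phi> (Suc (Suc i))"
      using Y(1) Fc(2)[of "Suc i"] Gc(2)[of i] by (intro assoc_mult_mat_dim[symmetric]) auto
    also have "\<dots> = X * (\<phi> (Suc i) * \<phi> (Suc (Suc i)))"
      unfolding Y(2) using X Fc(2)[of i] Fc(2)[of "Suc i"] by (intro assoc_mult_mat_dim) auto
    also have "\<dots> = 0\<^sub>m (dim_row (\<psi> (Suc i))) (a (Suc (Suc i)))"
      using X[THEN conjunct1] Fc(2)[of i] Gc(2)[of i] by (simp add: FF)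
    finally show "\<exists>Y. ?P (Suc i) Y \<and> \<psi> (Suc i) * Y = X * \<phi> (Suc i)" using Y by blast
  qed
  then show thesis using that by blast
qed

text \<open>A chain map that covers the zero map of \<open>I\<close> is null-homotopic. Each
  component of the homotopy lifts what remains of \<open>c\<close> once the contribution of the
  previous component has been subtracted.\<close>

lemma chain_homotopy_zero:
  assumes F: "ranked_resolution I a \<phi>"
    and c: "\<And>i. c i \<in> carrier_mat (a i) (a i)"
    and c0: "\<phi> 0 * c 0 = 0\<^sub>m 1 (a 0)"
    and cS: "\<And>i. \<phi> (Suc i) * c (Suc i) = c i * \<phi> (Suc i)"
  obtains h where
    "\<And>i. h i \<in> carrier_mat (a (Suc i)) (a i)"
    "c 0 = \<phi> (Suc 0) * h 0"
    "\<And>i. c (Suc i) = \<phi> (Suc (Suc i)) * h (Suc i) + h i * \<phi> (Suc i)"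
proof -
  \<comment> \<open>The middle condition says that \<open>c (Suc i) - X * \<phi> (Suc i)\<close> is
    a cycle, because \<open>\<phi> (Suc i) * c (Suc i) = c i * \<phi> (Suc i)\<close>; the next
    component is its lift.\<close>
  let ?P = "\<lambda>i X. X \<in> carrier_mat (a (Suc i)) (a i) \<and>
    \<phi> (Suc i) * (X * \<phi> (Suc i)) = c i * \<phi> (Suc i) \<and> (i = 0 \<longrightarrow> c 0 = \<phi> (Suc 0) * X)"
  note Fc = ranked_resolution_carrier(1,2)[OF F]
  note FF = ranked_resolution_complex[OF F]
  have "\<exists>h. \<forall>i. ?P i (h i) \<and> c (Suc i) = \<phi> (Suc (Suc i)) * h (Suc i) + h i * \<phi> (Suc i)"
  proof (rule dependent_nat_choice)
    obtain X where X: "X \<in> carrier_mat (a (Suc 0)) (a 0)" "\<phi> (Suc 0) * X = c 0"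
      using ranked_resolution_lift[OF F c, of 0] c0 Fc(1) by auto
    moreover have "\<phi> (Suc 0) * (X * \<phi> (Suc 0)) = \<phi> (Suc 0) * X * \<phi> (Suc 0)"
      using X(1) Fc(2)[of 0] by (intro assoc_mult_mat_dim[symmetric]) auto
    ultimately show "\<exists>X. ?P 0 X" by auto
  next
    fix X i assume X: "?P i X"
    have XF: "X * \<phi> (Suc i) \<in> carrier_mat (a (Suc i)) (a (Suc i))"
      using X Fc(2)[of i] by auto
    let ?B = "c (Suc i) - X * \<phi> (Suc i)"
    have B: "?B \<in> carrier_mat (a (Suc i)) (a (Suc i))"
      using XF by (rule minus_carrier_mat)
    have "\<phi> (Suc i) * ?B = \<phi> (Suc i) * c (Suc i) - \<phi> (Suc i) * (X * \<phi> (Suc i))"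
      using Fc(2)[of i] c XF by (rule mult_minus_distrib_mat)
    also have "\<dots> = 0\<^sub>m (dim_row (\<phi> (Suc i))) (a (Suc i))"
      using X Fc(2)[of i] c[of i] by (intro eq_matI) (auto simp: cS)
    finally obtain Y where Y: "Y \<in> carrier_mat (a (Suc (Suc i))) (a (Suc i))"
      "\<phi> (Suc (Suc i)) * Y = ?B"
      using ranked_resolution_lift[OF F B] by blast
    have "\<phi> (Suc (Suc i)) * (Y * \<phi> (Suc (Suc i))) = \<phi> (Suc (Suc i)) * Y * \<phi> (Suc (Suc i))"
      using Y(1) Fc(2)[of "Suc i"] by (intro assoc_mult_mat_dim[symmetric]) auto
    also have "\<dots> = c (Suc i) * \<phi> (Suc (Suc i)) - X * \<phi> (Suc i) * \<phi> (Suc (Suc i))"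
      unfolding Y using c XF Fc(2) by (rule minus_mult_distrib_mat)
    also have "X * \<phi> (Suc i) * \<phi> (Suc (Suc i)) = X * (\<phi> (Suc i) * \<phi> (Suc (Suc i)))"
      using X Fc(2)[of i] Fc(2)[of "Suc i"] by (intro assoc_mult_mat_dim) auto
    also have "\<dots> = 0\<^sub>m (a (Suc i)) (a (Suc (Suc i)))"
      using X[THEN conjunct1] Fc(2)[of i] by (simp add: FF)
    also have "c (Suc i) * \<phi> (Suc (Suc i)) - \<dots> = c (Suc i) * \<phi> (Suc (Suc i))"
      using c[of "Suc i"] Fc(2)[of "Suc i"] by (intro eq_matI) auto
    finally have "\<phi> (Suc (Suc i)) * (Y * \<phi> (Suc (Suc i))) = c (Suc i) * \<phi> (Suc (Suc i))" .
    moreover have "c (Suc i) = \<phi> (Suc (Suc i)) * Y + X * \<phi> (Suc i)"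
      unfolding Y using c[of "Suc i"] XF by (intro eq_matI) auto
    ultimately show "\<exists>Y. ?P (Suc i) Y \<and> c (Suc i) = \<phi> (Suc (Suc i)) * Y + X * \<phi> (Suc i)"
      using Y(1) by blast
  qed
  then show thesis using that by blast
qed

text \<open>Rank-nullity for \<open>f\<close> restricted to the kernel of \<open>D1\<close>: its
  image is the whole space of dimension \<open>b\<close> and its kernel is the range of
  \<open>D2\<close>. So cycles modulo boundaries have dimension \<open>b\<close>.\<close>

lemma kernel_dim_eq_rank_add:
  fixes D1 :: "'k::field mat"
  assumes D1: "D1 \<in> carrier_mat r n" and D2: "D2 \<in> carrier_mat n m" and f: "f \<in> carrier_mat b n"
    and surj: "\<And>w. w \<in> carrier_vec b \<Longrightarrow> \<exists>v\<in>mat_kernel D1. f *\<^sub>v v = w"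
    and ker: "{v \<in> mat_kernel D1. f *\<^sub>v v = 0\<^sub>v b} = mat_range D2"
  shows "kernel_dim D1 = vec_space.rank n D2 + b"
proof -
  interpret K: kernel r n D1 by unfold_locales (rule D1)
  interpret W: vec_space "TYPE('k)" b .
  let ?T = "\<lambda>v. f *\<^sub>v v"
  have sub: "mat_kernel D1 \<subseteq> carrier_vec n" using mat_kernel_carrier[OF D1] .
  interpret L: linear_map class_ring K.VK W.V ?T
    using f sub
    by unfold_locales (auto simp: LinearCombinations.module_hom_def mult_add_distrib_mat_vec subsetD
        mult_mat_vec module_vec_simps)
  obtain B where B: "finite B" "K.basis B"
    using kernel_basis_exists[OF D1] by blast
  have fd: "K.Ker.fin_dim" using B unfolding K.Ker.fin_dim_def K.Ker.basis_def by auto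
  have im: "L.im = carrier_vec b"
  proof -
    have "L.im = (\<lambda>v. f *\<^sub>v v) ` mat_kernel D1" unfolding L.im_def by simp
    also have "\<dots> = carrier_vec b"
    proof
      show "(\<lambda>v. f *\<^sub>v v) ` mat_kernel D1 \<subseteq> carrier_vec b" using f sub by auto
      show "carrier_vec b \<subseteq> (\<lambda>v. f *\<^sub>v v) ` mat_kernel D1" using surj by blast
    qed
    finally show ?thesis .
  qed
  have kr: "L.ker = mat_range D2"
    unfolding L.ker_def ker[symmetric] by (simp add: module_vec_simps)
  have rg: "mat_range D2 = K.NC.col_space D2"
  proof
    show "mat_range D2 \<subseteq> K.NC.col_space D2"
      unfolding K.NC.col_space_eq[OF D2] mat_range_def using D2 by auto
    show "K.NC.col_space D2 \<subseteq> mat_range D2"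
      unfolding K.NC.col_space_eq[OF D2] mat_range_def by blast
  qed
  have "vectorspace.dim class_ring (W.vs L.im) + vectorspace.dim class_ring (K.Ker.vs L.ker) = K.dim"
    by (rule L.rank_nullity[OF fd])
  moreover have "vectorspace.dim class_ring (W.vs L.im) = b"
    using W.dim_is_n unfolding im by (simp add: module_vec_def)
  moreover have "vectorspace.dim class_ring (K.Ker.vs L.ker) = vec_space.rank n D2"
    unfolding kr rg K.NC.rank_def K.NC.col_space_def by simp
  ultimately show ?thesis by simp
qed

section \<open>Betti numbers from a minimal resolution\<close>

text \<open>The difference of \<open>g i * f i\<close> and the identity is a chain map over zero,
  since both lift the identity of \<open>I\<close>; hence it is null-homotopic.\<close>

lemma comparison_maps_homotopic_identity:
  assumes F: "ranked_resolution I a \<phi>" and G: "ranked_resolution I b \<psi>"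
    and f: "\<And>i. f i \<in> carrier_mat (b i) (a i)" "\<psi> 0 * f 0 = \<phi> 0"
      "\<And>i. \<psi> (Suc i) * f (Suc i) = f i * \<phi> (Suc i)"
    and g: "\<And>i. g i \<in> carrier_mat (a i) (b i)" "\<phi> 0 * g 0 = \<psi> 0"
      "\<And>i. \<phi> (Suc i) * g (Suc i) = g i * \<psi> (Suc i)"
  obtains h where
    "\<And>i. h i \<in> carrier_mat (a (Suc i)) (a i)"
    "g 0 * f 0 = 1\<^sub>m (a 0) + \<phi> (Suc 0) * h 0"
    "\<And>i. g (Suc i) * f (Suc i) = 1\<^sub>m (a (Suc i)) + (\<phi> (Suc (Suc i)) * h (Suc i) + h i * \<phi> (Suc i))"
proof -
  note Fc = ranked_resolution_carrier(1,2)[OF F] and Gc = ranked_resolution_carrier(1,2)[OF G]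
  define c where "c i = g i * f i - 1\<^sub>m (a i)" for i
  have gf: "g i * f i \<in> carrier_mat (a i) (a i)" for i
    using f(1) g(1) by (rule mult_carrier_mat[rotated])
  have c: "c i \<in> carrier_mat (a i) (a i)" for i unfolding c_def by (rule minus_carrier_mat) simp
  have c0: "\<phi> 0 * c 0 = 0\<^sub>m 1 (a 0)"
  proof -
    have "\<phi> 0 * (g 0 * f 0) = \<phi> 0 * g 0 * f 0"
      using f(1)[of 0] g(1)[of 0] Fc(1) by (intro assoc_mult_mat_dim[symmetric]) auto
    then have "\<phi> 0 * (g 0 * f 0) = \<phi> 0" by (simp add: f(2) g(2))
    moreover have "\<phi> 0 * c 0 = \<phi> 0 * (g 0 * f 0) - \<phi> 0 * 1\<^sub>m (a 0)"
      unfolding c_def by (rule mult_minus_distrib_mat[OF Fc(1) gf]) simp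
    ultimately show ?thesis using Fc(1) by (auto intro!: eq_matI)
  qed
  have cS: "\<phi> (Suc i) * c (Suc i) = c i * \<phi> (Suc i)" for i
  proof -
    have "\<phi> (Suc i) * c (Suc i) = \<phi> (Suc i) * (g (Suc i) * f (Suc i)) - \<phi> (Suc i) * 1\<^sub>m (a (Suc i))"
      unfolding c_def by (rule mult_minus_distrib_mat[OF Fc(2) gf]) simp
    also have "\<phi> (Suc i) * (g (Suc i) * f (Suc i)) = \<phi> (Suc i) * g (Suc i) * f (Suc i)"
      using f(1)[of "Suc i"] g(1)[of "Suc i"] Fc(2)[of i] by (intro assoc_mult_mat_dim[symmetric]) auto
    also have "\<dots> = g i * \<psi> (Suc i) * f (Suc i)" by (simp only: g(3))
    also have "\<dots> = g i * (\<psi> (Suc i) * f (Suc i))"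
      using f(1)[of "Suc i"] g(1)[of i] Gc(2)[of i] by (intro assoc_mult_mat_dim) auto
    also have "\<dots> = g i * (f i * \<phi> (Suc i))" by (simp only: f(3))
    also have "\<dots> = g i * f i * \<phi> (Suc i)"
      using f(1)[of i] g(1)[of i] Fc(2)[of i] by (intro assoc_mult_mat_dim[symmetric]) auto
    also have "\<phi> (Suc i) * 1\<^sub>m (a (Suc i)) = 1\<^sub>m (a i) * \<phi> (Suc i)"
      using Fc(2)[of i] by simp
    also have "g i * f i * \<phi> (Suc i) - 1\<^sub>m (a i) * \<phi> (Suc i) = c i * \<phi> (Suc i)"
      unfolding c_def by (rule minus_mult_distrib_mat[OF gf _ Fc(2), symmetric]) simp
    finally show ?thesis .
  qed
  obtain h where h: "\<And>i. h i \<in> carrier_mat (a (Suc i)) (a i)" "c 0 = \<phi> (Suc 0) * h 0"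
    "\<And>i. c (Suc i) = \<phi> (Suc (Suc i)) * h (Suc i) + h i * \<phi> (Suc i)"
    using chain_homotopy_zero[OF F c c0 cS] by blast
  have "g i * f i = 1\<^sub>m (a i) + c i" for i
    unfolding c_def using gf[of i] by (intro eq_matI) auto
  then show thesis using that[OF h(1)] by (simp add: h(2,3))
qed

section \<open>Reduction modulo the variables\<close>

lemma residue_simps [simp]:
  "residue 0 = 0" "residue 1 = 1" "residue (f + g) = residue f + residue g"
  by (simp_all add: residue_def lookup_add)

text \<open>Taking the constant coefficient is multiplicative because two exponents add up to zero
  only if both are zero.\<close>

lemma residue_mult [simp]:
  fixes f g :: "('v, 'k::comm_ring_1) mpoly"
  shows "residue (f * g) = residue f * residue g"
proof -
  have zero: "(0 = l + q) = (l = 0 \<and> q = 0)" for l q :: "'v \<Rightarrow>\<^sub>0 nat"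
    by (auto simp: poly_mapping_eq_iff fun_eq_iff lookup_add)
  have "(x when (0 = l + q)) = ((x when q = 0) when l = 0)" for l q :: "'v \<Rightarrow>\<^sub>0 nat" and x :: 'k
    unfolding zero by (auto simp: when_def)
  then have "residue (f * g) =
      Sum_any (\<lambda>l. Poly_Mapping.lookup f l * Sum_any (\<lambda>q. (Poly_Mapping.lookup g q when q = 0) when l = 0))"
    unfolding residue_def lookup_mult by simp
  also have "\<dots> = Sum_any (\<lambda>l. Poly_Mapping.lookup f l * Poly_Mapping.lookup g 0 when l = 0)"
    by (simp add: mult_when Sum_any_when_independent)
  finally show ?thesis by (simp add: residue_def)
qed

lemma mult_mat_zero_vec:
  fixes A :: "'r::comm_ring_1 mat"
  assumes "A \<in> carrier_mat n m"
  shows "A *\<^sub>v 0\<^sub>v m = 0\<^sub>v n"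
  using assms by (intro eq_vecI) auto

lemma map_residue_mult:
  assumes "A \<in> carrier_mat n m" "B \<in> carrier_mat m c"
  shows "map_mat residue (A * B) = map_mat residue A * map_mat residue B"
proof -
  interpret semiring_hom residue by unfold_locales simp_all
  show ?thesis using assms by (rule mat_hom_mult)
qed

lemma map_residue_add:
  assumes "A \<in> carrier_mat n m" "B \<in> carrier_mat n m"
  shows "map_mat residue (A + B) = map_mat residue A + map_mat residue B"
  using assms by (intro eq_matI) auto

lemma map_residue_one: "map_mat residue (1\<^sub>m n) = 1\<^sub>m n"
  by (intro eq_matI) auto

lemma map_residue_zero: "map_mat residue (0\<^sub>m n m) = 0\<^sub>m n m"
  by (intro eq_matI) auto

text \<open>Modulo the variables all differentials of \<open>\<psi>\<close> vanish, so its homology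
  in degree \<open>i\<close> is the whole space of dimension \<open>b i\<close>. The comparison
  maps, inverse to each other up to homotopy, transfer this to the arbitrary resolution
  \<open>\<phi>\<close>.\<close>

lemma homology_dim_eq_minimal:
  fixes I :: "('v, 'k::field) mpoly set"
  assumes F: "ranked_resolution I a \<phi>" and G: "ranked_resolution I b \<psi>"
    and minimal: "\<And>i. map_mat residue (\<psi> (Suc i)) = 0\<^sub>m (b i) (b (Suc i))"
  shows "homology_dim \<phi> i = b i"
proof -
  note Fc = ranked_resolution_carrier(1,2)[OF F] and Gc = ranked_resolution_carrier(1,2)[OF G]
  obtain f where f: "\<And>i. f i \<in> carrier_mat (b i) (a i)" "\<psi> 0 * f 0 = \<phi> 0"
      "\<And>i. \<psi> (Suc i) * f (Suc i) = f i * \<phi> (Suc i)"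
    using comparison_map[OF F G] by blast
  obtain g where g: "\<And>i. g i \<in> carrier_mat (a i) (b i)" "\<phi> 0 * g 0 = \<psi> 0"
      "\<And>i. \<phi> (Suc i) * g (Suc i) = g i * \<psi> (Suc i)"
    using comparison_map[OF G F] by blast
  obtain h where h: "\<And>i. h i \<in> carrier_mat (a (Suc i)) (a i)"
    "g 0 * f 0 = 1\<^sub>m (a 0) + \<phi> (Suc 0) * h 0"
    "\<And>i. g (Suc i) * f (Suc i) = 1\<^sub>m (a (Suc i)) + (\<phi> (Suc (Suc i)) * h (Suc i) + h i * \<phi> (Suc i))"
    using comparison_maps_homotopic_identity[OF F G f g] by blast
  obtain k where k: "\<And>i. k i \<in> carrier_mat (b (Suc i)) (b i)"
    "f 0 * g 0 = 1\<^sub>m (b 0) + \<psi> (Suc 0) * k 0"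
    "\<And>i. f (Suc i) * g (Suc i) = 1\<^sub>m (b (Suc i)) + (\<psi> (Suc (Suc i)) * k (Suc i) + k i * \<psi> (Suc i))"
    using comparison_maps_homotopic_identity[OF G F g f] by blast
  let ?r = "map_mat residue"
  let ?d = "tensor_diff \<phi>"
  have rf: "?r (f i) \<in> carrier_mat (b i) (a i)" and rg: "?r (g i) \<in> carrier_mat (a i) (b i)"
    and rh: "?r (h i) \<in> carrier_mat (a (Suc i)) (a i)" for i
    using f(1) g(1) h(1) by simp_all
  have d: "?d (Suc i) = ?r (\<phi> (Suc i))" and rd: "?d (Suc i) \<in> carrier_mat (a i) (a (Suc i))" for i
    using Fc(2)[of i] by (simp_all add: tensor_diff_def)
  have d0: "?d 0 = 0\<^sub>m 0 (a 0)" using Fc(1) by (simp add: tensor_diff_def)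
  \<comment> \<open>\<open>r\<close> is the number of rows of the differential leaving degree
    \<open>i\<close>; it is 0 in degree 0, where the augmentation has been dropped.\<close>
  define r where "r = (case i of 0 \<Rightarrow> 0 | Suc j \<Rightarrow> a j)"
  have di: "?d i \<in> carrier_mat r (a i)"
    using rd d0 by (cases i) (auto simp: r_def)
  \<comment> \<open>On the minimal side each homotopy term contains a differential of
    \<open>\<psi>\<close> and vanishes after reduction, so \<open>f\<close> after \<open>g\<close>
    is exactly the identity.\<close>
  have fg: "?r (f i) * ?r (g i) = 1\<^sub>m (b i)"
  proof (cases i)
    case 0
    have "?r (f 0 * g 0) = 1\<^sub>m (b 0) + ?r (\<psi> (Suc 0)) * ?r (k 0)"
      unfolding k(2) using Gc(2)[of 0] k(1)[of 0]
      by (subst map_residue_add[of _ "b 0" "b 0"])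
         (auto simp: map_residue_one map_residue_mult[OF Gc(2) k(1)])
    then show ?thesis
      using k(1)[of 0] by (simp add: 0 minimal map_residue_mult[OF f(1) g(1)])
  next
    case (Suc j)
    have *: "\<psi> (Suc (Suc j)) * k (Suc j) \<in> carrier_mat (b (Suc j)) (b (Suc j))"
       "k j * \<psi> (Suc j) \<in> carrier_mat (b (Suc j)) (b (Suc j))"
      using mult_carrier_mat[OF Gc(2) k(1)] mult_carrier_mat[OF k(1) Gc(2)] by blast+
    have "?r (f (Suc j) * g (Suc j)) = 1\<^sub>m (b (Suc j)) +
      (?r (\<psi> (Suc (Suc j))) * ?r (k (Suc j)) + ?r (k j) * ?r (\<psi> (Suc j)))"
      unfolding k(3) map_residue_add[OF one_carrier_mat add_carrier_mat[OF *(2)]] map_residue_add[OF *]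
        map_residue_one map_residue_mult[OF Gc(2) k(1)] map_residue_mult[OF k(1) Gc(2)] ..
    then show ?thesis
      using k(1)[of j] k(1)[of "Suc j"] by (simp add: Suc minimal map_residue_mult[OF f(1) g(1)])
  qed
  \<comment> \<open>A cycle \<open>v\<close> killed by \<open>f\<close> is a boundary: one homotopy
    term vanishes because \<open>v\<close> is a cycle, and what remains reads
    \<open>0 = v + d (h v)\<close>.\<close>
  have gf: "v \<in> mat_range (?d (Suc i))" if v: "v \<in> mat_kernel (?d i)" and z: "?r (f i) *\<^sub>v v = 0\<^sub>v (b i)" for v
  proof -
    have vc: "v \<in> carrier_vec (a i)" and dv: "?d i *\<^sub>v v = 0\<^sub>v r" using mat_kernelD[OF di v] by auto
    define w where "w = ?r (h i) *\<^sub>v v"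
    have w: "w \<in> carrier_vec (a (Suc i))" using vc rh[of i] by (simp add: w_def)
    have dw: "?d (Suc i) *\<^sub>v w \<in> carrier_vec (a i)" using rd[of i] w by simp
    have "?r (g i * f i) *\<^sub>v v = v + ?d (Suc i) *\<^sub>v w"
    proof (cases i)
      case 0
      have *: "\<phi> (Suc 0) * h 0 \<in> carrier_mat (a 0) (a 0)"
        by (rule mult_carrier_mat[OF Fc(2) h(1)])
      have "?r (g 0 * f 0) = 1\<^sub>m (a 0) + ?d (Suc 0) * ?r (h 0)"
        unfolding h(2) map_residue_add[OF one_carrier_mat *] map_residue_one d
          map_residue_mult[OF Fc(2) h(1)] ..
      then show ?thesis
        using vc add_mult_distrib_mat_vec[OF one_carrier_mat mult_carrier_mat[OF rd[of 0] rh[of 0]], of v]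
          assoc_mult_mat_vec[OF rd[of 0] rh[of 0], of v]
        unfolding w_def 0 by simp
    next
      case (Suc j)
      have *: "\<phi> (Suc (Suc j)) * h (Suc j) \<in> carrier_mat (a (Suc j)) (a (Suc j))"
         "h j * \<phi> (Suc j) \<in> carrier_mat (a (Suc j)) (a (Suc j))"
        using mult_carrier_mat[OF Fc(2) h(1)] mult_carrier_mat[OF h(1) Fc(2)] by blast+
      have "?r (g (Suc j) * f (Suc j)) = 1\<^sub>m (a (Suc j)) +
        (?d (Suc (Suc j)) * ?r (h (Suc j)) + ?r (h j) * ?d (Suc j))"
        unfolding h(3) map_residue_add[OF one_carrier_mat add_carrier_mat[OF *(2)]] map_residue_add[OF *]
          map_residue_one map_residue_mult[OF Fc(2) h(1)] map_residue_mult[OF h(1) Fc(2)] d ..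
      moreover have E: "?d (Suc (Suc j)) * ?r (h (Suc j)) \<in> carrier_mat (a (Suc j)) (a (Suc j))"
         "?r (h j) * ?d (Suc j) \<in> carrier_mat (a (Suc j)) (a (Suc j))"
        using mult_carrier_mat[OF rd rh] mult_carrier_mat[OF rh rd] by blast+
      moreover have "?r (h j) * ?d (Suc j) *\<^sub>v v = 0\<^sub>v (a i)"
        using vc dv assoc_mult_mat_vec[OF rh[of j] rd[of j], of v] mult_mat_zero_vec[OF rh[of j]]
        unfolding Suc r_def by simp
      ultimately show ?thesis
        using vc dw add_mult_distrib_mat_vec[OF one_carrier_mat add_carrier_mat[OF E(2)], of v]
          add_mult_distrib_mat_vec[OF E, of v] assoc_mult_mat_vec[OF rd[of "Suc j"] rh[of "Suc j"], of v]
        unfolding w_def Suc by simp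
    qed
    moreover have "?r (g i * f i) *\<^sub>v v = 0\<^sub>v (a i)"
      unfolding map_residue_mult[OF g(1) f(1)] using z mult_mat_zero_vec[OF rg[of i]]
      by (simp add: assoc_mult_mat_vec[OF rg rf vc])
    ultimately have sum: "v + ?d (Suc i) *\<^sub>v w = 0\<^sub>v (a i)" by simp
    have "?d (Suc i) *\<^sub>v (- w) = - (?d (Suc i) *\<^sub>v w)"
      using mult_mat_vec[OF rd w, of "-1"] w rd[of i] by (intro eq_vecI) auto
    also have "\<dots> = v"
    proof (rule eq_vecI)
      fix j assume "j < dim_vec v"
      then have j: "j < a i" using vc by simp
      then have "v $ j + (?d (Suc i) *\<^sub>v w) $ j = 0"
        using arg_cong[OF sum, of "\<lambda>x. x $ j"] carrier_vecD[OF dw] by (simp only: index_add_vec index_zero_vec)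
      then show "(- (?d (Suc i) *\<^sub>v w)) $ j = v $ j"
        using j carrier_vecD[OF dw] by (simp add: add_eq_0_iff2)
    qed (use vc carrier_vecD[OF dw] in simp)
    finally show ?thesis
      using w rd[of i] unfolding mat_range_def by (intro image_eqI[of _ _ "- w"]) auto
  qed
  \<comment> \<open>\<open>f\<close> maps the cycles onto the space of dimension \<open>b i\<close>,
    as every \<open>w\<close> is the image of the cycle \<open>g w\<close>, and its kernel on cycles
    is the space of boundaries.\<close>
  have "kernel_dim (?d i) = vec_space.rank (a i) (?d (Suc i)) + b i"
  proof (rule kernel_dim_eq_rank_add[OF di rd rf])
    fix w :: "'k vec" assume w: "w \<in> carrier_vec (b i)"
    have gw: "?r (g i) *\<^sub>v w \<in> carrier_vec (a i)" using rg[of i] w by simp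
    have "?d i *\<^sub>v (?r (g i) *\<^sub>v w) = 0\<^sub>v r"
    proof (cases i)
      case 0
      then show ?thesis using gw by (simp add: r_def d0 zero_mat_mult_vec)
    next
      case (Suc j)
      have "?d i *\<^sub>v (?r (g i) *\<^sub>v w) = ?r (\<phi> (Suc j) * g (Suc j)) *\<^sub>v w"
        using w Suc by (simp add: d map_residue_mult[OF Fc(2) g(1)] assoc_mult_mat_vec[OF rd[unfolded d] rg])
      also have "\<dots> = (?r (g j) * 0\<^sub>m (b j) (b (Suc j))) *\<^sub>v w"
        by (simp only: g(3) map_residue_mult[OF g(1) Gc(2)] minimal)
      also have "\<dots> = 0\<^sub>v r"
        using w Suc rg[of j] by (simp add: r_def zero_mat_mult_vec)
      finally show ?thesis .
    qed
    then have "?r (g i) *\<^sub>v w \<in> mat_kernel (?d i)"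
      using mat_kernelI[OF di gw] by blast
    moreover have "?r (f i) *\<^sub>v (?r (g i) *\<^sub>v w) = w"
      using w by (simp add: assoc_mult_mat_vec[OF rf rg, symmetric] fg)
    ultimately show "\<exists>v\<in>mat_kernel (?d i). ?r (f i) *\<^sub>v v = w" by blast
  next
    have "?d (Suc i) *\<^sub>v u \<in> mat_kernel (?d i) \<and> ?r (f i) *\<^sub>v (?d (Suc i) *\<^sub>v u) = 0\<^sub>v (b i)"
      if u: "u \<in> carrier_vec (a (Suc i))" for u
    proof
      have du: "?d (Suc i) *\<^sub>v u \<in> carrier_vec (a i)" using rd[of i] u by simp
      have "?r (f i) *\<^sub>v (?d (Suc i) *\<^sub>v u) = ?r (f i * \<phi> (Suc i)) *\<^sub>v u"
        using u by (simp add: d map_residue_mult[OF f(1) Fc(2)] assoc_mult_mat_vec[OF rf rd[unfolded d]])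
      also have "\<dots> = 0\<^sub>m (b i) (b (Suc i)) * ?r (f (Suc i)) *\<^sub>v u"
        by (simp only: f(3)[symmetric] map_residue_mult[OF Gc(2) f(1)] minimal)
      also have "\<dots> = 0\<^sub>v (b i)"
        using u rf[of "Suc i"] by (simp add: zero_mat_mult_vec)
      finally show "?r (f i) *\<^sub>v (?d (Suc i) *\<^sub>v u) = 0\<^sub>v (b i)" .
      have "?d i *\<^sub>v (?d (Suc i) *\<^sub>v u) = 0\<^sub>v r"
      proof (cases i)
        case 0
        then show ?thesis using du by (simp add: r_def d0 zero_mat_mult_vec)
      next
        case (Suc j)
        have "?d i *\<^sub>v (?d (Suc i) *\<^sub>v u) = ?r (\<phi> (Suc j) * \<phi> (Suc (Suc j))) *\<^sub>v u"
          using u Suc by (simp add: d map_residue_mult[OF Fc(2) Fc(2)] assoc_mult_mat_vec[OF rd[unfolded d] rd[unfolded d]])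
        also have "\<dots> = 0\<^sub>v r"
          using u Suc Fc(2)[of j] by (simp add: ranked_resolution_complex[OF F] map_residue_zero r_def zero_mat_mult_vec)
        finally show ?thesis .
      qed
      then show "?d (Suc i) *\<^sub>v u \<in> mat_kernel (?d i)"
        using mat_kernelI[OF di du] by blast
    qed
    then have "mat_range (?d (Suc i)) \<subseteq> {v \<in> mat_kernel (?d i). ?r (f i) *\<^sub>v v = 0\<^sub>v (b i)}"
      using carrier_matD(2)[OF rd[of i]] unfolding mat_range_def by auto
    then show "{v \<in> mat_kernel (?d i). ?r (f i) *\<^sub>v v = 0\<^sub>v (b i)} = mat_range (?d (Suc i))"
      using gf by auto
  qed
  then show ?thesis
    using F unfolding homology_dim_def ranked_resolution_def by simp
qed

text \<open>\<open>betti\<close> picks its resolution by Hilbert choice. The given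
  \<open>\<psi>\<close> shows that there is something to choose, and every choice leads to the ranks
  of \<open>\<psi>\<close>.\<close>

lemma betti_eq_rank:
  fixes I :: "('v, 'k::field) mpoly set"
  assumes G: "ranked_resolution I b \<psi>"
    and minimal: "\<And>i. map_mat residue (\<psi> (Suc i)) = 0\<^sub>m (b i) (b (Suc i))"
  shows "betti I i = (if i < 0 then 0 else b (nat i))"
proof -
  let ?\<phi> = "SOME \<phi>. free_resolution I \<phi>"
  have "free_resolution I \<psi>" using G by (simp add: ranked_resolution_def)
  then have "free_resolution I ?\<phi>" by (rule someI[of "free_resolution I" \<psi>])
  then have "ranked_resolution I (\<lambda>i. dim_col (?\<phi> i)) ?\<phi>"
    by (simp add: ranked_resolution_def)
  then show ?thesis
    unfolding betti_def using homology_dim_eq_minimal[OF _ G minimal] by auto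
qed

section \<open>Linear resolutions and mapping cones\<close>

definition monomial_degree :: "('v \<Rightarrow>\<^sub>0 nat) \<Rightarrow> nat" where
  "monomial_degree m = (\<Sum>x\<in>Poly_Mapping.keys m. Poly_Mapping.lookup m x)"

definition homogeneous :: "nat \<Rightarrow> ('v, 'k::comm_ring_1) mpoly \<Rightarrow> bool" where
  "homogeneous d f \<longleftrightarrow> (\<forall>m\<in>Poly_Mapping.keys f. monomial_degree m = d)"

definition homogeneous_component :: "nat \<Rightarrow> ('v, 'k::comm_ring_1) mpoly \<Rightarrow> ('v, 'k) mpoly" where
  "homogeneous_component d f = Poly_Mapping.mapp (\<lambda>m c. c when monomial_degree m = d) f"

lemma keys_add_nat: "Poly_Mapping.keys (m + m') = Poly_Mapping.keys m \<union> Poly_Mapping.keys m'" for m m' :: "'v \<Rightarrow>\<^sub>0 nat"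
  by (auto simp: in_keys_iff lookup_add)

lemma monomial_degree_superset:
  "finite A \<Longrightarrow> Poly_Mapping.keys m \<subseteq> A \<Longrightarrow> monomial_degree m = (\<Sum>x\<in>A. Poly_Mapping.lookup m x)"
  unfolding monomial_degree_def by (rule sum.mono_neutral_left) (auto simp: in_keys_iff)

lemma monomial_degree_add: "monomial_degree (m + m') = monomial_degree m + monomial_degree m'"
proof -
  let ?A = "Poly_Mapping.keys m \<union> Poly_Mapping.keys m'"
  show ?thesis
    by (simp add: monomial_degree_superset[of ?A] keys_add_nat lookup_add sum.distrib)
qed

lemma lookup_homogeneous_component:
  "Poly_Mapping.lookup (homogeneous_component d f) m =
    (if monomial_degree m = d then Poly_Mapping.lookup f m else 0)"
  by (simp add: homogeneous_component_def lookup_mapp in_keys_iff when_def)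

lemma homogeneous_homogeneous_component: "homogeneous d (homogeneous_component d f)"
  by (auto simp: homogeneous_def in_keys_iff lookup_homogeneous_component split: if_splits)

lemma homogeneous_component_eq: "homogeneous d f \<Longrightarrow> homogeneous_component d f = f"
  by (rule poly_mapping_eqI) (auto simp: homogeneous_def in_keys_iff lookup_homogeneous_component)

lemma homogeneous_component_add:
  "homogeneous_component d (f + g) = homogeneous_component d f + homogeneous_component d g"
  by (rule poly_mapping_eqI) (simp add: lookup_homogeneous_component lookup_add)

lemma homogeneous_component_sum:
  "homogeneous_component d (\<Sum>x\<in>A. f x) = (\<Sum>x\<in>A. homogeneous_component d (f x))"
  by (rule poly_mapping_eqI) (simp add: lookup_homogeneous_component lookup_sum)

lemma homogeneous_zero [simp]: "homogeneous d 0"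
  by (simp add: homogeneous_def)

lemma homogeneous_uminus: "homogeneous d f \<Longrightarrow> homogeneous d (- f)"
  by (auto simp: homogeneous_def in_keys_iff)

lemma homogeneous_sum: "(\<And>x. x \<in> A \<Longrightarrow> homogeneous d (f x)) \<Longrightarrow> homogeneous d (sum f A)"
  using keys_sum[of f A] by (force simp: homogeneous_def)

lemma homogeneous_mult: "homogeneous d f \<Longrightarrow> homogeneous e g \<Longrightarrow> homogeneous (d + e) (f * g)"
  using keys_mult[of f g] by (force simp: homogeneous_def monomial_degree_add)

text \<open>The part of \<open>g\<close> outside degree \<open>e\<close> contributes to
  \<open>f * g\<close> only in degrees other than \<open>d + e\<close>, by additivity of the
  degree.\<close>

lemma homogeneous_component_mult:
  assumes f: "homogeneous d f"
  shows "homogeneous_component (d + e) (f * g) = f * homogeneous_component e g"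
proof -
  let ?r = "g - homogeneous_component e g"
  have r: "monomial_degree m \<noteq> e" if "m \<in> Poly_Mapping.keys ?r" for m
    using that by (auto simp: in_keys_iff lookup_minus lookup_homogeneous_component)
  have "m \<notin> Poly_Mapping.keys (f * ?r)" if m: "monomial_degree m = d + e" for m
  proof
    assume "m \<in> Poly_Mapping.keys (f * ?r)"
    then obtain a b where "a \<in> Poly_Mapping.keys f" "b \<in> Poly_Mapping.keys ?r" "m = a + b"
      using keys_mult[of f ?r] by blast
    then show False using f r m by (auto simp: homogeneous_def monomial_degree_add)
  qed
  then have "homogeneous_component (d + e) (f * ?r) = 0"
    by (intro poly_mapping_eqI) (simp add: lookup_homogeneous_component in_keys_iff)
  moreover have "f * g = f * homogeneous_component e g + f * ?r"
    by (simp add: algebra_simps)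
  ultimately show ?thesis
    using homogeneous_component_eq[OF homogeneous_mult[OF f homogeneous_homogeneous_component[of e g]]]
    by (simp add: homogeneous_component_add)
qed

definition homogeneous_mat :: "nat \<Rightarrow> ('v, 'k::comm_ring_1) mpoly mat \<Rightarrow> bool" where
  "homogeneous_mat d A \<longleftrightarrow> (\<forall>i<dim_row A. \<forall>j<dim_col A. homogeneous d (A $$ (i, j)))"

lemma homogeneous_mat_mult:
  assumes "A \<in> carrier_mat n m" "B \<in> carrier_mat m c"
    and "homogeneous_mat d A" "homogeneous_mat e B"
  shows "homogeneous_mat (d + e) (A * B)"
  using assms unfolding homogeneous_mat_def
  by (auto simp: scalar_prod_def intro!: homogeneous_sum homogeneous_mult)

text \<open>Only the parts of degree \<open>e\<close> of the entries of \<open>X\<close> contribute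
  to the homogeneous product. This lets any lift be replaced by a homogeneous one, which keeps
  mapping cones linear.\<close>

lemma homogeneous_factor:
  assumes A: "A \<in> carrier_mat n m" and X: "X \<in> carrier_mat m c"
    and hA: "homogeneous_mat d A" and hB: "homogeneous_mat (d + e) (A * X)"
  shows "A * map_mat (homogeneous_component e) X = A * X"
proof (rule eq_matI)
  fix i j assume ij: "i < dim_row (A * X)" "j < dim_col (A * X)"
  then have i: "i < n" and j: "j < c" using A X by auto
  have entry: "(A * X) $$ (i, j) = (\<Sum>k = 0..<m. A $$ (i, k) * X $$ (k, j))"
    using A X i j by (auto simp: scalar_prod_def)
  have "(A * X) $$ (i, j) = homogeneous_component (d + e) ((A * X) $$ (i, j))"
    using hB ij by (simp add: homogeneous_mat_def homogeneous_component_eq)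
  also have "\<dots> =
      (\<Sum>k = 0..<m. A $$ (i, k) * homogeneous_component e (X $$ (k, j)))"
    unfolding entry homogeneous_component_sum
    using hA A i by (intro sum.cong) (auto simp: homogeneous_mat_def homogeneous_component_mult)
  also have "\<dots> = (A * map_mat (homogeneous_component e) X) $$ (i, j)"
    using A X i j by (auto simp: scalar_prod_def)
  finally show "(A * map_mat (homogeneous_component e) X) $$ (i, j) = (A * X) $$ (i, j)" by simp
qed (use A X in auto)

section \<open>Linear resolutions\<close>

definition linear_resolution :: "nat \<Rightarrow> (nat \<Rightarrow> nat) \<Rightarrow> ('v, 'k::comm_ring_1) mpoly set \<Rightarrow> bool" where
  "linear_resolution d b I \<longleftrightarrow>
    (\<exists>\<phi>. ranked_resolution I b \<phi> \<and> homogeneous_mat d (\<phi> 0) \<and> (\<forall>i. homogeneous_mat 1 (\<phi> (Suc i))))"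

text \<open>A linear form has no constant term, so the differentials vanish modulo the variables and
  the resolution is minimal.\<close>

lemma betti_linear_resolution:
  fixes I :: "('v, 'k::field) mpoly set"
  assumes "linear_resolution d b I"
  shows "betti I i = (if i < 0 then 0 else b (nat i))"
proof -
  obtain \<phi> where res: "ranked_resolution I b \<phi>" and hom: "\<And>i. homogeneous_mat 1 (\<phi> (Suc i))"
    using assms unfolding linear_resolution_def by blast
  have zero: "residue f = 0" if "homogeneous 1 f" for f :: "('v, 'k) mpoly"
  proof (rule ccontr)
    assume "residue f \<noteq> 0"
    then have "0 \<in> Poly_Mapping.keys f" by (simp add: residue_def in_keys_iff)
    with that show False by (auto simp: homogeneous_def monomial_degree_def)
  qed
  have "map_mat residue (\<phi> (Suc i)) = 0\<^sub>m (b i) (b (Suc i))" for i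
    using hom[of i] ranked_resolution_carrier(2)[OF res, of i]
    by (intro eq_matI) (auto simp: homogeneous_mat_def zero)
  then show ?thesis by (rule betti_eq_rank[OF res])
qed

section \<open>Mapping cones\<close>

text \<open>Exactness of a mapping cone at one spot. The premise \<open>lift\<close> stays abstract
  because it has two sources: exactness of the second complex in positive degrees and the colon
  condition in degree 0.\<close>

lemma block_mat_exact:
  fixes A :: "'r::comm_ring_1 mat"
  assumes A: "A \<in> carrier_mat m a" and A': "A' \<in> carrier_mat a a'"
    and B: "B \<in> carrier_mat m c" and B': "B' \<in> carrier_mat a c'"
    and C: "C \<in> carrier_mat l c" and C': "C' \<in> carrier_mat c c'"
    and exact: "mat_range A' = mat_kernel A"
    and AB: "A * B' + B * C' = 0\<^sub>m m c'" and CC: "C * C' = 0\<^sub>m l c'"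
    and lift: "\<And>w x. w \<in> carrier_vec c \<Longrightarrow> x \<in> carrier_vec a \<Longrightarrow> C *\<^sub>v w = 0\<^sub>v l \<Longrightarrow>
      A *\<^sub>v x + B *\<^sub>v w = 0\<^sub>v m \<Longrightarrow> w \<in> mat_range C'"
  shows "mat_range (four_block_mat A' B' (0\<^sub>m c a') C') = mat_kernel (four_block_mat A B (0\<^sub>m l a) C)"
    (is "mat_range ?M' = mat_kernel ?M")
proof -
  have M: "?M \<in> carrier_mat (m + l) (a + c)" and M': "?M' \<in> carrier_mat (a + c) (a' + c')"
    using A C A' C' by auto
  have Mv: "?M *\<^sub>v (x @\<^sub>v w) = (A *\<^sub>v x + B *\<^sub>v w) @\<^sub>v C *\<^sub>v w"
    if "x \<in> carrier_vec a" "w \<in> carrier_vec c" for x w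
    using four_block_mat_mult_vec[OF A B zero_carrier_mat C that] that C
    by (simp add: zero_mat_mult_vec)
  have M'v: "?M' *\<^sub>v (x @\<^sub>v w) = (A' *\<^sub>v x + B' *\<^sub>v w) @\<^sub>v C' *\<^sub>v w"
    if "x \<in> carrier_vec a'" "w \<in> carrier_vec c'" for x w
    using four_block_mat_mult_vec[OF A' B' zero_carrier_mat C' that] that C'
    by (simp add: zero_mat_mult_vec)
  have split: "\<exists>x w. v = x @\<^sub>v w \<and> x \<in> carrier_vec p \<and> w \<in> carrier_vec q"
    if "v \<in> carrier_vec (p + q)" for v :: "'r vec" and p q
    using vec_first_last_append[OF that] by (metis vec_first_carrier vec_last_carrier)
  have ABv: "A *\<^sub>v (B' *\<^sub>v w) + B *\<^sub>v (C' *\<^sub>v w) = 0\<^sub>v m" if w: "w \<in> carrier_vec c'" for w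
  proof -
    have "(A * B' + B * C') *\<^sub>v w = A *\<^sub>v (B' *\<^sub>v w) + B *\<^sub>v (C' *\<^sub>v w)"
      using add_mult_distrib_mat_vec[OF mult_carrier_mat[OF A B'] mult_carrier_mat[OF B C'] w]
      by (simp add: assoc_mult_mat_vec[OF A B' w] assoc_mult_mat_vec[OF B C' w])
    then show ?thesis using w by (simp add: AB zero_mat_mult_vec)
  qed
  show ?thesis
  proof (intro equalityI subsetI)
    fix v assume "v \<in> mat_range ?M'"
    then obtain u where u: "u \<in> carrier_vec (a' + c')" and v: "v = ?M' *\<^sub>v u"
      using M' unfolding mat_range_def by auto
    obtain x w where uxw: "u = x @\<^sub>v w" and x: "x \<in> carrier_vec a'" and w: "w \<in> carrier_vec c'"
      using split[OF u] by blast
    have "A' *\<^sub>v x \<in> mat_kernel A" using exact x A' unfolding mat_range_def by auto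
    then have Ax: "A *\<^sub>v (A' *\<^sub>v x) = 0\<^sub>v m" using mat_kernelD[OF A] by blast
    have c1: "A' *\<^sub>v x \<in> carrier_vec a" and c2: "B' *\<^sub>v w \<in> carrier_vec a" and c3: "C' *\<^sub>v w \<in> carrier_vec c"
      using A' B' C' x w by auto
    have "A *\<^sub>v (A' *\<^sub>v x + B' *\<^sub>v w) + B *\<^sub>v (C' *\<^sub>v w) = 0\<^sub>v m"
      using ABv[OF w] c1 c2 c3 A B by (simp add: mult_add_distrib_mat_vec[OF A c1 c2] Ax)
    moreover have "C *\<^sub>v (C' *\<^sub>v w) = 0\<^sub>v l"
      using assoc_mult_mat_vec[OF C C' w] w by (simp add: CC zero_mat_mult_vec)
    ultimately have "?M *\<^sub>v v = 0\<^sub>v (m + l)"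
      unfolding v uxw M'v[OF x w] using c1 c2 c3 by (subst Mv) auto
    moreover have "v \<in> carrier_vec (a + c)" using M' u v by auto
    ultimately show "v \<in> mat_kernel ?M" using mat_kernelI[OF M] by blast
  next
    fix v assume "v \<in> mat_kernel ?M"
    then have v: "v \<in> carrier_vec (a + c)" and z: "?M *\<^sub>v v = 0\<^sub>v (m + l)"
      using mat_kernelD[OF M] by blast+
    obtain x w where vxw: "v = x @\<^sub>v w" and x: "x \<in> carrier_vec a" and w: "w \<in> carrier_vec c"
      using split[OF v] by blast
    have Axw: "A *\<^sub>v x + B *\<^sub>v w \<in> carrier_vec m" and Cw: "C *\<^sub>v w \<in> carrier_vec l"
      using A B C x w by auto
    have "(A *\<^sub>v x + B *\<^sub>v w) @\<^sub>v C *\<^sub>v w = 0\<^sub>v m @\<^sub>v 0\<^sub>v l"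
      using z unfolding vxw Mv[OF x w] by auto
    then have z1: "A *\<^sub>v x + B *\<^sub>v w = 0\<^sub>v m" and z2: "C *\<^sub>v w = 0\<^sub>v l"
      using append_vec_eq[OF Axw zero_carrier_vec] by auto
    \<comment> \<open>The second component comes from \<open>w'\<close>; subtracting
      \<open>B' *\<^sub>v w'\<close> from the first one leaves an element of the kernel of
      \<open>A\<close>, which exactness lifts.\<close>
    obtain w' where w': "w' \<in> carrier_vec c'" and ww: "w = C' *\<^sub>v w'"
      using lift[OF w x z2 z1] C' unfolding mat_range_def by auto
    have c2: "B' *\<^sub>v w' \<in> carrier_vec a" using B' w' by auto
    have "A *\<^sub>v (x - B' *\<^sub>v w') = A *\<^sub>v x - A *\<^sub>v (B' *\<^sub>v w')"
      by (rule mult_minus_distrib_mat_vec[OF A x c2])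
    also have "\<dots> = 0\<^sub>v m"
    proof (rule eq_vecI)
      fix i assume "i < dim_vec (0\<^sub>v m :: 'r vec)"
      then have i: "i < m" by simp
      have "(A *\<^sub>v x) $ i + (B *\<^sub>v w) $ i = 0" "(A *\<^sub>v (B' *\<^sub>v w')) $ i + (B *\<^sub>v w) $ i = 0"
        using arg_cong[OF z1, of "\<lambda>x. x $ i"] arg_cong[OF ABv[OF w'], of "\<lambda>x. x $ i"] i B
        unfolding ww by (simp_all del: index_mult_mat_vec)
      then show "(A *\<^sub>v x - A *\<^sub>v (B' *\<^sub>v w')) $ i = 0\<^sub>v m $ i"
        using i A by (simp add: add_eq_0_iff2 del: index_mult_mat_vec)
    qed (use A in auto)
    finally have "x - B' *\<^sub>v w' \<in> mat_kernel A"
      using x c2 by (intro mat_kernelI[OF A]) auto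
    then obtain t where t: "t \<in> carrier_vec a'" and xt: "x - B' *\<^sub>v w' = A' *\<^sub>v t"
      using A' unfolding exact[symmetric] mat_range_def by auto
    have "x = A' *\<^sub>v t + B' *\<^sub>v w'"
      unfolding xt[symmetric] using x B' by (intro eq_vecI) auto
    then have "v = ?M' *\<^sub>v (t @\<^sub>v w')"
      unfolding M'v[OF t w'] vxw ww by simp
    then show "v \<in> mat_range ?M'"
      using t w' M' unfolding mat_range_def by auto
  qed
qed

lemma homogeneous_mat_map_component:
  "homogeneous_mat d (map_mat (homogeneous_component d) A)"
  by (auto simp: homogeneous_mat_def homogeneous_homogeneous_component)

lemma homogeneous_mat_uminus: "homogeneous_mat d A \<Longrightarrow> homogeneous_mat d (- A)"
  by (auto simp: homogeneous_mat_def homogeneous_uminus)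

lemma homogeneous_mat_four_block:
  assumes "A \<in> carrier_mat m a" "B \<in> carrier_mat m c" "C \<in> carrier_mat l c"
    and "homogeneous_mat d A" "homogeneous_mat d B" "homogeneous_mat d C"
  shows "homogeneous_mat d (four_block_mat A B (0\<^sub>m l a) C)"
  using assms by (auto simp: homogeneous_mat_def)

text \<open>Multiplication by \<open>u\<close> carries \<open>J\<close> into \<open>I\<close> and so
  extends to a map of the resolutions augmented by the ring itself, hence the index shift in
  \<open>case_nat 1 b\<close> and \<open>case_nat 1 c\<close>. The maps anticommute with the
  differentials, so that the block differential of the cone squares to zero.\<close>

lemma cone_maps:
  fixes \<phi> \<kappa> :: "nat \<Rightarrow> ('v, 'k::comm_ring_1) mpoly mat"
  assumes F: "ranked_resolution I b \<phi>" and hF: "homogeneous_mat d (\<phi> 0)" "\<And>i. homogeneous_mat 1 (\<phi> (Suc i))"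
    and K: "ranked_resolution J c \<kappa>" and hK: "\<And>i. homogeneous_mat 1 (\<kappa> i)"
    and J: "\<And>g. g \<in> J \<Longrightarrow> u * g \<in> I" and u: "homogeneous d u"
  obtains s where
    "s 0 = mat 1 1 (\<lambda>_. u)"
    "\<And>i. s i \<in> carrier_mat (case_nat 1 b i) (case_nat 1 c i)"
    "homogeneous_mat d (s 0)" "\<And>i. homogeneous_mat 1 (s (Suc i))"
    "\<And>i. \<phi> i * s (Suc i) + s i * \<kappa> i = 0\<^sub>m (case_nat 1 b i) (c i)"
proof -
  define b' c' where "b' = case_nat 1 b" and "c' = case_nat 1 c"
  \<comment> \<open>\<open>e i\<close> is the common degree of the entries of
    \<open>\<phi> i\<close> and \<open>s i\<close>: \<open>d\<close> at the start and 1
    afterwards.\<close>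
  define e where "e = case_nat d (\<lambda>_. 1::nat)"
  have Fc: "\<phi> i \<in> carrier_mat (b' i) (b i)" for i
    using ranked_resolution_carrier(1,2)[OF F] by (cases i) (simp_all add: b'_def)
  have Kc: "\<kappa> i \<in> carrier_mat (c' i) (c i)" for i
    using ranked_resolution_carrier(1,2)[OF K] by (cases i) (simp_all add: c'_def)
  have hF': "homogeneous_mat (e i) (\<phi> i)" for i using hF by (cases i) (simp_all add: e_def)
  have Suc_simps: "b' (Suc i) = b i" "c' (Suc i) = c i" "e (Suc i) = 1" for i
    by (simp_all add: b'_def c'_def e_def)
  \<comment> \<open>The third condition, that \<open>X * \<kappa> i\<close> factors through
    \<open>\<phi> i\<close>, is what allows the next component to be defined.\<close>
  let ?P = "\<lambda>i X. X \<in> carrier_mat (b' i) (c' i) \<and> homogeneous_mat (e i) X \<and>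
    (\<exists>Y\<in>carrier_mat (b i) (c i). \<phi> i * Y = X * \<kappa> i) \<and> (i = 0 \<longrightarrow> X = mat 1 1 (\<lambda>_. u))"
  have "\<exists>s. \<forall>i. ?P i (s i) \<and> \<phi> i * s (Suc i) + s i * \<kappa> i = 0\<^sub>m (b' i) (c i)"
  proof (rule dependent_nat_choice)
    let ?U = "mat 1 1 (\<lambda>_. u)"
    have U: "?U \<in> carrier_mat (b' 0) (c' 0)" by (simp add: b'_def c'_def)
    have "(?U * \<kappa> 0) $$ (0, j) \<in> I" if j: "j < c 0" for j
    proof -
      have "(?U * \<kappa> 0) $$ (0, j) = u * \<kappa> 0 $$ (0, j)"
        using j Kc[of 0] by (simp add: c'_def scalar_prod_def)
      then show ?thesis using J ranked_resolution_entry0[OF K j] by simp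
    qed
    moreover have "?U * \<kappa> 0 \<in> carrier_mat 1 (c 0)"
      using mult_carrier_mat[OF U Kc] by (simp add: b'_def)
    ultimately obtain Y where "Y \<in> carrier_mat (b 0) (c 0)" "\<phi> 0 * Y = ?U * \<kappa> 0"
      using ranked_resolution_lift0[OF F] by blast
    moreover have "homogeneous_mat (e 0) ?U" using u by (simp add: homogeneous_mat_def e_def)
    ultimately show "\<exists>X. ?P 0 X" using U by blast
  next
    fix X i assume X: "?P i X"
    then obtain Y where Y: "Y \<in> carrier_mat (b i) (c i)" "\<phi> i * Y = X * \<kappa> i" by blast
    have Xc: "X \<in> carrier_mat (b' i) (c' i)" and hX: "homogeneous_mat (e i) X" using X by blast+
    \<comment> \<open>The lift \<open>Y\<close> is cut down to its linear part, which by homogeneity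
      has the same product with \<open>\<phi> i\<close>; the minus sign produces
      anticommutation.\<close>
    define Z where "Z = - map_mat (homogeneous_component 1) Y"
    have Zc: "Z \<in> carrier_mat (b' (Suc i)) (c' (Suc i))" using Y(1) by (simp add: Z_def Suc_simps)
    have hZ: "homogeneous_mat (e (Suc i)) Z"
      unfolding Z_def Suc_simps by (intro homogeneous_mat_uminus homogeneous_mat_map_component)
    have "\<phi> i * map_mat (homogeneous_component 1) Y = \<phi> i * Y"
      using homogeneous_factor[OF Fc Y(1) hF'] homogeneous_mat_mult[OF Xc Kc hX hK] Y(2) by simp
    moreover have "\<phi> i * Z = - (\<phi> i * map_mat (homogeneous_component 1) Y)"
      unfolding Z_def using Y(1) Fc[of i] by (intro uminus_mult_right_mat) auto
    ultimately have pZ: "\<phi> i * Z = - (X * \<kappa> i)" using Y(2) by simp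
    have XK: "X * \<kappa> i \<in> carrier_mat (b' i) (c i)" using Xc Kc by (rule mult_carrier_mat)
    have sum: "\<phi> i * Z + X * \<kappa> i = 0\<^sub>m (b' i) (c i)"
      unfolding pZ using XK by (rule uminus_l_inv_mat)
    have ZK: "Z * \<kappa> (Suc i) \<in> carrier_mat (b i) (c (Suc i))"
      using mult_carrier_mat[OF Zc Kc] by (simp add: Suc_simps)
    have "\<phi> i * (Z * \<kappa> (Suc i)) = \<phi> i * Z * \<kappa> (Suc i)"
      using Fc[of i] Zc Kc[of "Suc i"] by (intro assoc_mult_mat_dim[symmetric]) (auto simp: Suc_simps)
    also have "\<dots> = - (X * \<kappa> i * \<kappa> (Suc i))"
      unfolding pZ using XK Kc[of "Suc i"] by (intro uminus_mult_left_mat) (auto simp: Suc_simps)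
    also have "X * \<kappa> i * \<kappa> (Suc i) = X * (\<kappa> i * \<kappa> (Suc i))"
      using Xc Kc[of i] Kc[of "Suc i"] by (intro assoc_mult_mat_dim) (auto simp: Suc_simps)
    also have "\<dots> = 0\<^sub>m (b' i) (c (Suc i))"
      using Xc Kc[of i] by (simp add: ranked_resolution_complex[OF K])
    finally have "\<phi> i * (Z * \<kappa> (Suc i)) = 0\<^sub>m (dim_row (\<phi> i)) (c (Suc i))"
      using Fc[of i] by (auto intro: eq_matI)
    then have "\<exists>Y\<in>carrier_mat (b (Suc i)) (c (Suc i)). \<phi> (Suc i) * Y = Z * \<kappa> (Suc i)"
      by (rule ranked_resolution_lift[OF F ZK])
    then show "\<exists>Z. ?P (Suc i) Z \<and> \<phi> i * Z + X * \<kappa> i = 0\<^sub>m (b' i) (c i)"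
      using Zc hZ sum by blast
  qed
  then obtain s where s: "\<And>i. ?P i (s i)" "\<And>i. \<phi> i * s (Suc i) + s i * \<kappa> i = 0\<^sub>m (b' i) (c i)"
    by blast
  have "homogeneous_mat (e i) (s i)" for i using s(1) by blast
  from this[of 0] this[of "Suc _"] have "homogeneous_mat d (s 0)" "\<And>i. homogeneous_mat 1 (s (Suc i))"
    by (simp_all add: e_def)
  moreover have "s 0 = mat 1 1 (\<lambda>_. u)" "s i \<in> carrier_mat (b' i) (c' i)" for i
    using s(1) by blast+
  ultimately show thesis using that[of s] s(2) unfolding b'_def c'_def by blast
qed

text \<open>The colon ideal \<open>J\<close> describes the multiples of the new generator
  \<open>u\<close> that already lie in \<open>I\<close>, and the mapping cone of multiplication by
  \<open>u\<close> resolves \<open>I + (u)\<close>. It adds rank \<open>c (i - 1)\<close> in degree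
  \<open>i > 0\<close>, while \<open>u\<close> itself accounts for the 1 in degree 0.\<close>

lemma linear_resolution_cone:
  fixes I J I' :: "('v, 'k::comm_ring_1) mpoly set"
  assumes I: "linear_resolution d b I" and J: "linear_resolution 1 c J"
    and u: "homogeneous d u" and colon: "J = {g. u * g \<in> I}"
    and I': "I' = {a + u * g | a g. a \<in> I}"
  shows "linear_resolution d (\<lambda>i. b i + case_nat 1 c i) I'"
proof -
  obtain \<phi> where F: "ranked_resolution I b \<phi>" and hF: "homogeneous_mat d (\<phi> 0)" "\<And>i. homogeneous_mat 1 (\<phi> (Suc i))"
    using I unfolding linear_resolution_def by blast
  obtain \<kappa> where K: "ranked_resolution J c \<kappa>" and hK': "homogeneous_mat 1 (\<kappa> 0)" "\<And>i. homogeneous_mat 1 (\<kappa> (Suc i))"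
    using J unfolding linear_resolution_def by blast
  have hK: "homogeneous_mat 1 (\<kappa> i)" for i using hK' by (cases i) simp_all
  obtain s where s0: "s 0 = mat 1 1 (\<lambda>_. u)"
    and s: "\<And>i. s i \<in> carrier_mat (case_nat 1 b i) (case_nat 1 c i)"
    and hs: "homogeneous_mat d (s 0)" "\<And>i. homogeneous_mat 1 (s (Suc i))"
    and ss: "\<And>i. \<phi> i * s (Suc i) + s i * \<kappa> i = 0\<^sub>m (case_nat 1 b i) (c i)"
    using cone_maps[OF F hF K hK _ u] colon by blast
  define b' c' where "b' = case_nat 1 b" and "c' = case_nat 1 c"
  \<comment> \<open>The complex of \<open>J\<close> is extended downwards: \<open>\<kappa> 0\<close>
    becomes a differential into the ring, and the ring maps to the zero module by the matrix
    \<open>C 0\<close> without rows; \<open>l i\<close> counts the rows of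
    \<open>C i\<close>.\<close>
  define l where "l = case_nat 0 c'"
  define C where "C = case_nat (0\<^sub>m 0 1) \<kappa>"
  define \<psi> where "\<psi> i = four_block_mat (\<phi> i) (s i) (0\<^sub>m (l i) (b i)) (C i)" for i
  have Suc_simps: "b' 0 = 1" "c' 0 = 1" "l 0 = 0" "b' (Suc i) = b i" "c' (Suc i) = c i" "l (Suc i) = c' i"
    "C 0 = 0\<^sub>m 0 1" "C (Suc i) = \<kappa> i" for i
    by (simp_all add: b'_def c'_def l_def C_def)
  have Fc: "\<phi> i \<in> carrier_mat (b' i) (b i)" for i
    using ranked_resolution_carrier(1,2)[OF F] by (cases i) (simp_all add: b'_def)
  have Kc: "\<kappa> i \<in> carrier_mat (c' i) (c i)" for i
    using ranked_resolution_carrier(1,2)[OF K] by (cases i) (simp_all add: c'_def)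
  have Cc: "C i \<in> carrier_mat (l i) (c' i)" for i
    using Kc by (cases i) (simp_all add: Suc_simps)
  have sc: "s i \<in> carrier_mat (b' i) (c' i)" for i using s unfolding b'_def c'_def .
  have sS: "s (Suc i) \<in> carrier_mat (b i) (c i)" for i using sc[of "Suc i"] by (simp add: Suc_simps)
  have \<psi>c: "\<psi> i \<in> carrier_mat (b' i + l i) (b i + c' i)" for i
    unfolding \<psi>_def using Fc Cc by (rule four_block_carrier_mat)
  have "mat_range (\<psi> (Suc i)) = mat_kernel (\<psi> i)" for i
    unfolding \<psi>_def Suc_simps
  proof (rule block_mat_exact[OF Fc _ sc sS Cc Kc])
    show "\<phi> (Suc i) \<in> carrier_mat (b i) (b (Suc i))" using Fc[of "Suc i"] by (simp add: Suc_simps)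
    show "mat_range (\<phi> (Suc i)) = mat_kernel (\<phi> i)" by (rule ranked_resolution_range(2)[OF F])
    show "\<phi> i * s (Suc i) + s i * \<kappa> i = 0\<^sub>m (b' i) (c i)" using ss unfolding b'_def .
    show "C i * \<kappa> i = 0\<^sub>m (l i) (c i)"
    proof (cases i)
      case 0
      show ?thesis using Kc[of 0] by (simp add: 0 Suc_simps)
    next
      case (Suc j)
      have "dim_row (\<kappa> j) = c' j" using Kc[of j] by simp
      then show ?thesis unfolding Suc Suc_simps ranked_resolution_complex[OF K] by simp
    qed
    show "w \<in> mat_range (\<kappa> i)" if w: "w \<in> carrier_vec (c' i)" and x: "x \<in> carrier_vec (b i)"
      and Cw: "C i *\<^sub>v w = 0\<^sub>v (l i)" and sum: "\<phi> i *\<^sub>v x + s i *\<^sub>v w = 0\<^sub>v (b' i)" for w x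
    proof (cases i)
      case (Suc j)
      then have "w \<in> mat_kernel (\<kappa> j)"
        using w Cw by (intro mat_kernelI[OF Kc]) (simp_all add: Suc_simps)
      then show ?thesis unfolding Suc by (simp add: ranked_resolution_range(2)[OF K])
    next
      \<comment> \<open>In degree 0 the equation says \<open>u * w $ 0 \<in> I\<close>, so
        \<open>w $ 0\<close> lies in the colon ideal \<open>J\<close>, onto which
        \<open>\<kappa> 0\<close> maps.\<close>
      case 0
      have F0: "\<phi> 0 \<in> carrier_mat 1 (b 0)" using Fc[of 0] by (simp add: Suc_simps)
      have w1: "w \<in> carrier_vec 1" and x0: "x \<in> carrier_vec (b 0)" using w x 0 by (simp_all add: Suc_simps)
      have "(s 0 *\<^sub>v w) $ 0 = u * w $ 0" using w1 by (simp add: s0 scalar_prod_def)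
      then have "(\<phi> 0 *\<^sub>v x) $ 0 + u * w $ 0 = 0"
        using arg_cong[OF sum, of "\<lambda>v. v $ 0"] F0 by (simp add: 0 s0 Suc_simps del: index_mult_mat_vec)
      moreover have "(\<phi> 0 *\<^sub>v (- x)) $ 0 = - (\<phi> 0 *\<^sub>v x) $ 0"
        using F0 x0 by simp
      ultimately have "(\<phi> 0 *\<^sub>v (- x)) $ 0 = u * w $ 0"
        by (simp add: neg_eq_iff_add_eq_0 del: index_mult_mat_vec)
      moreover have "\<phi> 0 *\<^sub>v (- x) \<in> mat_range (\<phi> 0)"
        using F0 x0 unfolding mat_range_def by auto
      ultimately have "w $ 0 \<in> J"
        unfolding colon ranked_resolution_range(1)[OF F] by (simp del: index_mult_mat_vec)
      then show ?thesis using w1 by (simp add: 0 ranked_resolution_range(1)[OF K])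
    qed
  qed
  \<comment> \<open>The augmentation of the cone is the row \<open>\<phi> 0\<close> followed by
    \<open>u\<close>, with range \<open>I + (u)\<close>.\<close>
  moreover have "mat_range (\<psi> 0) = {v \<in> carrier_vec 1. v $ 0 \<in> I'}"
  proof -
    have F0: "\<phi> 0 \<in> carrier_mat 1 (b 0)" using Fc[of 0] by (simp add: Suc_simps)
    have \<psi>0: "\<psi> 0 \<in> carrier_mat 1 (b 0 + 1)" using \<psi>c[of 0] by (simp add: Suc_simps)
    have s0c: "s 0 \<in> carrier_mat 1 1" by (simp add: s0)
    have \<psi>v: "(\<psi> 0 *\<^sub>v (x @\<^sub>v w)) $ 0 = (\<phi> 0 *\<^sub>v x) $ 0 + u * w $ 0"
      if x: "x \<in> carrier_vec (b 0)" and w: "w \<in> carrier_vec 1" for x w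
    proof -
      have "\<psi> 0 *\<^sub>v (x @\<^sub>v w) = (\<phi> 0 *\<^sub>v x + s 0 *\<^sub>v w) @\<^sub>v (0\<^sub>m 0 (b 0) *\<^sub>v x + 0\<^sub>m 0 1 *\<^sub>v w)"
        unfolding \<psi>_def Suc_simps using four_block_mat_mult_vec[OF F0 s0c zero_carrier_mat zero_carrier_mat x w] .
      moreover have "(s 0 *\<^sub>v w) $ 0 = u * w $ 0" using w by (simp add: s0 scalar_prod_def)
      ultimately show ?thesis using F0 s0c by (simp del: index_mult_mat_vec)
    qed
    have Irange: "(\<exists>x\<in>carrier_vec (b 0). (\<phi> 0 *\<^sub>v x) $ 0 = a) \<longleftrightarrow> a \<in> I" for a
    proof
      assume "\<exists>x\<in>carrier_vec (b 0). (\<phi> 0 *\<^sub>v x) $ 0 = a"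
      then obtain x where x: "x \<in> carrier_vec (b 0)" "(\<phi> 0 *\<^sub>v x) $ 0 = a" by blast
      then have "\<phi> 0 *\<^sub>v x \<in> mat_range (\<phi> 0)" using F0 unfolding mat_range_def by auto
      then show "a \<in> I" using x unfolding ranked_resolution_range(1)[OF F] by simp
    next
      assume "a \<in> I"
      then have "vec 1 (\<lambda>_. a) \<in> mat_range (\<phi> 0)" by (simp add: ranked_resolution_range(1)[OF F])
      then obtain x where x: "x \<in> carrier_vec (b 0)" and v: "\<phi> 0 *\<^sub>v x = vec 1 (\<lambda>_. a)"
        using F0 unfolding mat_range_def by auto
      have "(\<phi> 0 *\<^sub>v x) $ 0 = a" unfolding v by simp
      with x show "\<exists>x\<in>carrier_vec (b 0). (\<phi> 0 *\<^sub>v x) $ 0 = a" by blast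
    qed
    show ?thesis
    proof (intro equalityI subsetI)
      fix v assume "v \<in> mat_range (\<psi> 0)"
      then obtain y where y: "y \<in> carrier_vec (b 0 + 1)" and v: "v = \<psi> 0 *\<^sub>v y"
        using \<psi>0 unfolding mat_range_def by auto
      have "y = vec_first y (b 0) @\<^sub>v vec_last y 1" using vec_first_last_append[OF y] by simp
      then have "v $ 0 = (\<phi> 0 *\<^sub>v vec_first y (b 0)) $ 0 + u * vec_last y 1 $ 0"
        unfolding v using \<psi>v[OF vec_first_carrier vec_last_carrier, of y y] by simp
      then have "v $ 0 \<in> I'"
        unfolding I' using Irange vec_first_carrier by blast
      moreover have "v \<in> carrier_vec 1" unfolding v by (rule mult_mat_vec_carrier[OF \<psi>0 y])
      ultimately show "v \<in> {v \<in> carrier_vec 1. v $ 0 \<in> I'}" by blast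
    next
      fix v assume "v \<in> {v \<in> carrier_vec 1. v $ 0 \<in> I'}"
      then obtain a g where v: "v \<in> carrier_vec 1" and a: "a \<in> I" and vag: "v $ 0 = a + u * g"
        unfolding I' by blast
      obtain x where x: "x \<in> carrier_vec (b 0)" "(\<phi> 0 *\<^sub>v x) $ 0 = a" using Irange a by blast
      have "v = \<psi> 0 *\<^sub>v (x @\<^sub>v vec 1 (\<lambda>_. g))"
      proof (rule eq_vecI)
        fix i assume "i < dim_vec (\<psi> 0 *\<^sub>v (x @\<^sub>v vec 1 (\<lambda>_. g)))"
        then have "i = 0" using \<psi>0 by simp
        then show "v $ i = (\<psi> 0 *\<^sub>v (x @\<^sub>v vec 1 (\<lambda>_. g))) $ i"
          using \<psi>v[OF x(1), of "vec 1 (\<lambda>_. g)"] x(2) vag by simp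
      qed (use v \<psi>0 in simp)
      moreover have "x @\<^sub>v vec 1 (\<lambda>_. g) \<in> carrier_vec (b 0 + 1)" using x(1) by (intro carrier_vecI) simp
      ultimately show "v \<in> mat_range (\<psi> 0)"
        using \<psi>0 unfolding mat_range_def by auto
    qed
  qed
  moreover have "dim_row (\<psi> 0) = 1" "dim_row (\<psi> (Suc i)) = dim_col (\<psi> i)" "dim_col (\<psi> i) = b i + c' i" for i
    using \<psi>c[of 0] \<psi>c[of i] \<psi>c[of "Suc i"] by (simp_all add: Suc_simps)
  ultimately have "ranked_resolution I' (\<lambda>i. b i + c' i) \<psi>"
    unfolding ranked_resolution_def free_resolution_def by blast
  moreover have "homogeneous_mat d (\<psi> 0)"
    unfolding \<psi>_def using hF hs by (intro homogeneous_mat_four_block[OF Fc sc Cc]) (simp_all add: Suc_simps homogeneous_mat_def)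
  moreover have "homogeneous_mat 1 (\<psi> (Suc i))" for i
    unfolding \<psi>_def using hF(2) hs(2) hK
    by (intro homogeneous_mat_four_block[OF Fc sc Cc]) (simp_all only: Suc_simps)
  ultimately show ?thesis unfolding linear_resolution_def c'_def by blast
qed

section \<open>Squarefree monomial ideals with linear quotients\<close>

text \<open>Generators are represented by their sets of variables. A squarefree monomial divides a
  monomial exactly when its variables lie in the support, so membership is a test on the supports of
  the terms.\<close>

definition squarefree_ideal :: "'v set set \<Rightarrow> ('v, 'k::comm_ring_1) mpoly set" where
  "squarefree_ideal \<W> = {f. \<forall>m\<in>Poly_Mapping.keys f. \<exists>A\<in>\<W>. A \<subseteq> Poly_Mapping.keys m}"

definition squarefree_exponent :: "'v set \<Rightarrow> ('v \<Rightarrow>\<^sub>0 nat)" where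
  "squarefree_exponent A = (\<Sum>x\<in>A. Poly_Mapping.single x 1)"

lemma lookup_squarefree_exponent:
  "finite A \<Longrightarrow> Poly_Mapping.lookup (squarefree_exponent A) x = (if x \<in> A then 1 else 0)"
  by (simp add: squarefree_exponent_def lookup_sum lookup_single when_def)

lemma keys_squarefree_exponent: "finite A \<Longrightarrow> Poly_Mapping.keys (squarefree_exponent A) = A"
  by (auto simp: in_keys_iff lookup_squarefree_exponent split: if_splits)

lemma prod_var: "finite A \<Longrightarrow> (\<Prod>x\<in>A. var x) = Poly_Mapping.single (squarefree_exponent A) 1"
  by (induction A rule: finite_induct) (simp_all add: squarefree_exponent_def var_def mult_single)

text \<open>Subtraction of exponents truncates at 0; it is exact here because the squarefree
  monomial of \<open>A\<close> divides \<open>m\<close>.\<close>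

lemma squarefree_exponent_split:
  assumes "finite A" "A \<subseteq> Poly_Mapping.keys m"
  shows "squarefree_exponent A + (m - squarefree_exponent A) = m"
proof (rule poly_mapping_eqI)
  fix x
  have "x \<in> A \<Longrightarrow> 0 < Poly_Mapping.lookup m x" using assms(2) by (auto simp: in_keys_iff)
  then show "Poly_Mapping.lookup (squarefree_exponent A + (m - squarefree_exponent A)) x = Poly_Mapping.lookup m x"
    using assms(1) by (simp add: lookup_add lookup_minus lookup_squarefree_exponent)
qed

lemma mpoly_sum_monomials:
  "f = (\<Sum>m\<in>Poly_Mapping.keys f. Poly_Mapping.single m (Poly_Mapping.lookup f m))"
  by (rule poly_mapping_eqI) (simp add: lookup_sum lookup_single when_def in_keys_iff)

lemma lookup_monomial_mult:
  fixes g :: "('v, 'k::comm_ring_1) mpoly"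
  shows "Poly_Mapping.lookup (Poly_Mapping.single a 1 * g) (a + m) = Poly_Mapping.lookup g m"
proof -
  have "Poly_Mapping.lookup (Poly_Mapping.single a 1 * g) (a + m) =
      Sum_any (\<lambda>l. Sum_any (\<lambda>q. Poly_Mapping.lookup g q when a + m = l + q) when l = a)"
    unfolding lookup_mult lookup_single by (intro Sum_any.cong) (auto simp: when_def)
  also have "\<dots> = Sum_any (\<lambda>l. Sum_any (\<lambda>q. Poly_Mapping.lookup g q when q = m) when l = a)"
    by (intro Sum_any.cong when_cong refl) auto
  finally show ?thesis by simp
qed

lemma keys_monomial_mult:
  fixes g :: "('v, 'k::comm_ring_1) mpoly"
  shows "Poly_Mapping.keys (Poly_Mapping.single a 1 * g) = (+) a ` Poly_Mapping.keys g"
proof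
  show "Poly_Mapping.keys (Poly_Mapping.single a 1 * g) \<subseteq> (+) a ` Poly_Mapping.keys g"
    using keys_mult[of "Poly_Mapping.single a 1" g] by auto
  show "(+) a ` Poly_Mapping.keys g \<subseteq> Poly_Mapping.keys (Poly_Mapping.single a 1 * g)"
    by (auto simp: in_keys_iff lookup_monomial_mult)
qed

lemma module_ring_over_itself: "Modules.module ((*) :: 'r::comm_ring_1 \<Rightarrow> 'r \<Rightarrow> 'r)"
  by (rule Modules.module.intro) (simp_all only: distrib_left distrib_right mult.assoc mult_1_left)

text \<open>Membership by supports is closed under the module operations and holds for the
  generators; conversely each term of such a polynomial is a multiple of one generator.\<close>

lemma ideal_gen_squarefree:
  fixes \<W> :: "'v set set"
  assumes fin: "\<And>A. A \<in> \<W> \<Longrightarrow> finite A"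
  shows "ideal_gen {\<Prod>x\<in>A. var x | A. A \<in> \<W>} = (squarefree_ideal \<W> :: ('v, 'k::comm_ring_1) mpoly set)"
proof -
  interpret R: Modules.module "(*) :: ('v, 'k) mpoly \<Rightarrow> _"
    by (rule module_ring_over_itself)
  let ?G = "{\<Prod>x\<in>A. var x | A. A \<in> \<W>} :: ('v, 'k) mpoly set"
  show ?thesis
  proof
    have "R.subspace (squarefree_ideal \<W>)"
      unfolding R.subspace_def
    proof (intro conjI ballI allI)
      show "0 \<in> squarefree_ideal \<W>" by (simp add: squarefree_ideal_def)
    next
      fix f g :: "('v, 'k) mpoly"
      assume "f \<in> squarefree_ideal \<W>" "g \<in> squarefree_ideal \<W>"
      then show "f + g \<in> squarefree_ideal \<W>"
        using keys_add[of f g] unfolding squarefree_ideal_def by blast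
    next
      fix f g :: "('v, 'k) mpoly"
      assume g: "g \<in> squarefree_ideal \<W>"
      show "f * g \<in> squarefree_ideal \<W>"
        unfolding squarefree_ideal_def
      proof (intro CollectI ballI)
        fix m assume "m \<in> Poly_Mapping.keys (f * g)"
        then obtain a b where b: "b \<in> Poly_Mapping.keys g" and m: "m = a + b" using keys_mult[of f g] by blast
        obtain A where "A \<in> \<W>" "A \<subseteq> Poly_Mapping.keys b"
          using g b unfolding squarefree_ideal_def by blast
        then show "\<exists>A\<in>\<W>. A \<subseteq> Poly_Mapping.keys m"
          unfolding m keys_add_nat by blast
      qed
    qed
    moreover have "?G \<subseteq> squarefree_ideal \<W>"
      using fin by (auto simp: squarefree_ideal_def prod_var keys_squarefree_exponent)
    ultimately show "ideal_gen ?G \<subseteq> squarefree_ideal \<W>"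
      unfolding ideal_gen_def by (intro R.span_minimal)
  next
    show "squarefree_ideal \<W> \<subseteq> ideal_gen ?G"
    proof
      fix f :: "('v, 'k) mpoly" assume f: "f \<in> squarefree_ideal \<W>"
      have "Poly_Mapping.single m (Poly_Mapping.lookup f m) \<in> R.span ?G" if m: "m \<in> Poly_Mapping.keys f" for m
      proof -
        obtain A where A: "A \<in> \<W>" "A \<subseteq> Poly_Mapping.keys m"
          using f m unfolding squarefree_ideal_def by blast
        have "Poly_Mapping.single m (Poly_Mapping.lookup f m) =
            Poly_Mapping.single (m - squarefree_exponent A) (Poly_Mapping.lookup f m) * (\<Prod>x\<in>A. var x)"
          using squarefree_exponent_split[OF fin[OF A(1)] A(2)]
          by (simp add: prod_var[OF fin[OF A(1)]] mult_single add.commute)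
        also have "\<dots> \<in> R.span ?G"
          using A(1) by (intro R.span_scale R.span_base) blast
        finally show ?thesis .
      qed
      then have "(\<Sum>m\<in>Poly_Mapping.keys f. Poly_Mapping.single m (Poly_Mapping.lookup f m)) \<in> R.span ?G"
        by (intro R.span_sum)
      then show "f \<in> ideal_gen ?G"
        unfolding ideal_gen_def using mpoly_sum_monomials[of f] by simp
    qed
  qed
qed

section \<open>Linear quotients\<close>

text \<open>The start of the iteration: all modules have rank 0, and matrices without columns are
  homogeneous of every degree.\<close>

lemma linear_resolution_zero: "linear_resolution d (\<lambda>_. 0) {0 :: ('v, 'k::comm_ring_1) mpoly}"
proof -
  define \<phi> :: "nat \<Rightarrow> ('v, 'k) mpoly mat" where "\<phi> i = 0\<^sub>m (case_nat 1 (\<lambda>_. 0) i) 0" for i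
  have range: "mat_range (0\<^sub>m n 0) = {0\<^sub>v n}" for n :: nat
    unfolding mat_range_def by (auto simp: zero_mat_mult_vec intro!: image_eqI[of _ _ "0\<^sub>v 0"])
  have one: "{v \<in> carrier_vec 1. v $ 0 \<in> {0}} = {0\<^sub>v 1 :: ('v, 'k) mpoly vec}"
    by (auto intro!: eq_vecI)
  have kernel: "mat_kernel (0\<^sub>m n 0) = {0\<^sub>v 0 :: ('v, 'k) mpoly vec}" for n :: nat
    unfolding mat_kernel_def by (auto simp: zero_mat_mult_vec intro!: eq_vecI)
  have "ranked_resolution {0} (\<lambda>_. 0) \<phi>"
    unfolding ranked_resolution_def free_resolution_def \<phi>_def
    using range[of 1] range[of 0] kernel one by (simp split: nat.split)
  then show ?thesis
    unfolding linear_resolution_def by (auto intro!: exI[of _ \<phi>] simp: homogeneous_mat_def \<phi>_def)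
qed

lemma homogeneous_squarefree_monomial:
  "finite A \<Longrightarrow> homogeneous (card A) (Poly_Mapping.single (squarefree_exponent A) 1)"
  by (auto simp: homogeneous_def monomial_degree_def keys_squarefree_exponent lookup_squarefree_exponent
      split: if_splits)

lemma squarefree_ideal_insert:
  assumes A: "finite A"
  shows "(squarefree_ideal (insert A \<W>) :: ('v, 'k::comm_ring_1) mpoly set) =
    {a + Poly_Mapping.single (squarefree_exponent A) 1 * g | a g. a \<in> squarefree_ideal \<W>}"
proof (intro equalityI subsetI)
  fix f :: "('v, 'k) mpoly" assume f: "f \<in> squarefree_ideal (insert A \<W>)"
  let ?Q = "\<lambda>m. \<exists>B\<in>\<W>. B \<subseteq> Poly_Mapping.keys m"
  \<comment> \<open>\<open>M\<close> collects the monomials of \<open>f\<close> outside the old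
    ideal. Each is divisible by the new generator, so their part of \<open>f\<close> is a multiple
    of it, with cofactor \<open>g\<close>, and the rest of \<open>f\<close> lies in the old
    ideal.\<close>
  define M where "M = {m \<in> Poly_Mapping.keys f. \<not> ?Q m}"
  define g where "g = (\<Sum>m\<in>M. Poly_Mapping.single (m - squarefree_exponent A) (Poly_Mapping.lookup f m))"
  have finM: "finite M" by (simp add: M_def)
  have sub: "A \<subseteq> Poly_Mapping.keys m" if "m \<in> M" for m
    using f that by (auto simp: squarefree_ideal_def M_def)
  have ug: "Poly_Mapping.single (squarefree_exponent A) 1 * g =
      (\<Sum>m\<in>M. Poly_Mapping.single m (Poly_Mapping.lookup f m))"
    unfolding g_def sum_distrib_left
    by (rule sum.cong) (simp_all add: mult_single squarefree_exponent_split[OF A sub])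
  let ?a = "f - Poly_Mapping.single (squarefree_exponent A) 1 * g"
  have "Poly_Mapping.lookup ?a m = (if m \<in> M then 0 else Poly_Mapping.lookup f m)" for m
    unfolding ug using finM by (auto simp: lookup_minus lookup_sum lookup_single when_def)
  then have "?a \<in> squarefree_ideal \<W>"
    by (auto simp: squarefree_ideal_def in_keys_iff M_def split: if_splits)
  moreover have "f = ?a + Poly_Mapping.single (squarefree_exponent A) 1 * g" by simp
  ultimately show "f \<in> {a + Poly_Mapping.single (squarefree_exponent A) 1 * g | a g. a \<in> squarefree_ideal \<W>}"
    by blast
next
  fix f :: "('v, 'k) mpoly"
  assume "f \<in> {a + Poly_Mapping.single (squarefree_exponent A) 1 * g | a g. a \<in> squarefree_ideal \<W>}"
  then obtain a g where a: "a \<in> squarefree_ideal \<W>"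
    and f: "f = a + Poly_Mapping.single (squarefree_exponent A) 1 * g" by blast
  have "A \<subseteq> Poly_Mapping.keys m" if "m \<in> Poly_Mapping.keys (Poly_Mapping.single (squarefree_exponent A) 1 * g)" for m
    using that A by (auto simp: keys_monomial_mult keys_add_nat keys_squarefree_exponent)
  then show "f \<in> squarefree_ideal (insert A \<W>)"
    using a keys_add[of a "Poly_Mapping.single (squarefree_exponent A) 1 * g"]
    unfolding f squarefree_ideal_def by blast
qed

text \<open>\<open>K\<close> plays the role of the support of a multiplier, whose product with the
  generator of \<open>A\<close> has support \<open>A \<union> K\<close>. The premise
  \<open>colon\<close> thus says that the colon ideal is generated by the variables in
  \<open>V\<close>.\<close>

lemma linear_resolution_squarefree_insert:
  fixes \<W> :: "'v set set"
  assumes I: "linear_resolution (card A) b (squarefree_ideal \<W> :: ('v, 'k::comm_ring_1) mpoly set)"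
    and J: "linear_resolution 1 c (squarefree_ideal ((\<lambda>x. {x}) ` V) :: ('v, 'k) mpoly set)"
    and A: "finite A"
    and colon: "\<And>K. finite K \<Longrightarrow> (\<exists>B\<in>\<W>. B \<subseteq> A \<union> K) \<longleftrightarrow> K \<inter> V \<noteq> {}"
  shows "linear_resolution (card A) (\<lambda>i. b i + case_nat 1 c i)
    (squarefree_ideal (insert A \<W>) :: ('v, 'k) mpoly set)"
proof (rule linear_resolution_cone[OF I J homogeneous_squarefree_monomial[OF A] _ squarefree_ideal_insert[OF A]])
  have "(\<exists>B\<in>(\<lambda>x. {x}) ` V. B \<subseteq> K) \<longleftrightarrow> K \<inter> V \<noteq> {}" for K :: "'v set" by auto
  then show "squarefree_ideal ((\<lambda>x. {x}) ` V) =
      {g :: ('v, 'k) mpoly. Poly_Mapping.single (squarefree_exponent A) 1 * g \<in> squarefree_ideal \<W>}"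
    by (simp add: squarefree_ideal_def keys_monomial_mult keys_add_nat keys_squarefree_exponent A colon)
qed

text \<open>The ranks of the Koszul complex: variables are adjoined one at a time, and the colon
  ideal at a new variable is generated by the earlier ones. The shift \<open>Suc i\<close> arises
  because the ideal is resolved and not its quotient ring.\<close>

lemma linear_resolution_variables:
  assumes "finite V"
  shows "linear_resolution 1 (\<lambda>i. card V choose Suc i)
    (squarefree_ideal ((\<lambda>x. {x}) ` V) :: ('v, 'k::comm_ring_1) mpoly set)"
  using assms
proof (induction V rule: finite_induct)
  case empty
  have "squarefree_ideal {} = {0 :: ('v, 'k) mpoly}" by (auto simp: squarefree_ideal_def)
  then show ?case using linear_resolution_zero by simp
next
  case (insert x V)
  have "(\<exists>B\<in>(\<lambda>x. {x}) ` V. B \<subseteq> {x} \<union> K) \<longleftrightarrow> K \<inter> V \<noteq> {}" for K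
    using insert.hyps(2) by auto
  from linear_resolution_squarefree_insert[where A = "{x}", OF _ insert.IH _ this] insert.IH
  have "linear_resolution 1 (\<lambda>i. (card V choose Suc i) + case_nat 1 (\<lambda>i. card V choose Suc i) i)
      (squarefree_ideal (insert {x} ((\<lambda>x. {x}) ` V)) :: ('v, 'k) mpoly set)" by simp
  \<comment> \<open>Pascal's rule; in degree 0 the 1 from \<open>case_nat\<close> is
    \<open>card V choose 0\<close>.\<close>
  moreover have "(card V choose Suc i) + case_nat 1 (\<lambda>i. card V choose Suc i) i = card (insert x V) choose Suc i" for i
    using insert.hyps by (cases i) simp_all
  ultimately show ?case by simp
qed

text \<open>The new generator supplies \<open>card V choose 0\<close> in degree 0, and in higher
  degrees the shift of the cone cancels the one in the resolution of the variables.\<close>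

lemma linear_resolution_linear_quotient:
  fixes \<W> :: "'v set set"
  assumes I: "linear_resolution (card A) b (squarefree_ideal \<W> :: ('v, 'k::comm_ring_1) mpoly set)"
    and A: "finite A" and V: "finite V"
    and colon: "\<And>K. finite K \<Longrightarrow> (\<exists>B\<in>\<W>. B \<subseteq> A \<union> K) \<longleftrightarrow> K \<inter> V \<noteq> {}"
  shows "linear_resolution (card A) (\<lambda>i. b i + (card V choose i))
    (squarefree_ideal (insert A \<W>) :: ('v, 'k) mpoly set)"
proof -
  have "case_nat 1 (\<lambda>i. card V choose Suc i) i = card V choose i" for i by (cases i) simp_all
  then show ?thesis
    using linear_resolution_squarefree_insert[OF I linear_resolution_variables[OF V] A colon] by simp
qed

section \<open>Isotone maps and multichain covers\<close>

text \<open>The maps live on labels, with the order pulled back along \<open>p\<close>; they are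
  extensional, so that each map on \<open>L\<close> is counted once.\<close>

definition isotone_maps :: "('j \<Rightarrow> 'a::order) \<Rightarrow> 'j set \<Rightarrow> nat \<Rightarrow> ('j \<Rightarrow> nat) set" where
  "isotone_maps p L e = {f \<in> L \<rightarrow>\<^sub>E {1..e}. \<forall>a\<in>L. \<forall>b\<in>L. p a \<le> p b \<longrightarrow> f a \<le> f b}"

definition graph_of :: "'j set \<Rightarrow> ('j \<Rightarrow> nat) \<Rightarrow> (nat \<times> 'j) set" where
  "graph_of L f = (\<lambda>j. (f j, j)) ` L"

text \<open>The vertex \<open>(Suc r, j)\<close> stands for raising the value at \<open>j\<close>
  from at most \<open>r\<close> to \<open>Suc r\<close> and leaving all others. For fixed
  \<open>r\<close> the labels \<open>j\<close> that occur are those of the maximal elements of the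
  part where \<open>f\<close> is at most \<open>r\<close>.\<close>

definition raising_moves :: "('j \<Rightarrow> 'a::order) \<Rightarrow> 'j set \<Rightarrow> nat \<Rightarrow> ('j \<Rightarrow> nat) \<Rightarrow> (nat \<times> 'j) set" where
  "raising_moves p L e f =
    {(Suc r, j) | r j. 1 \<le> r \<and> r < e \<and> j \<in> L \<and> f j \<le> r \<and> (\<forall>k\<in>L. p j < p k \<longrightarrow> r < f k)}"

lemma raising_moves_iff:
  "(Suc r, j) \<in> raising_moves p L e f \<longleftrightarrow>
    1 \<le> r \<and> r < e \<and> j \<in> L \<and> f j \<le> r \<and> (\<forall>k\<in>L. p j < p k \<longrightarrow> r < f k)"
  unfolding raising_moves_def by auto

lemma finite_isotone_maps: "finite L \<Longrightarrow> finite (isotone_maps p L e)"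
  unfolding isotone_maps_def by (simp add: finite_PiE)

lemma finite_raising_moves: "finite L \<Longrightarrow> finite (raising_moves p L e f)"
  by (rule finite_subset[of _ "{..e} \<times> L"]) (auto simp: raising_moves_def)

lemma finite_graph_of: "finite L \<Longrightarrow> finite (graph_of L f)"
  by (simp add: graph_of_def)

lemma card_graph_of: "card (graph_of L f) = card L"
  unfolding graph_of_def by (rule card_image) (auto intro: inj_onI)

text \<open>The sum of the values is strictly monotone in the pointwise order, so a map of least sum
  in a family is pointwise minimal there.\<close>

lemma isotone_maps_eqI:
  assumes "finite L" "f \<in> isotone_maps p L e" "g \<in> isotone_maps p L e"
    and le: "\<And>j. j \<in> L \<Longrightarrow> g j \<le> f j" and sum: "sum f L \<le> sum g L"
  shows "g = f"
proof -
  have "\<not> (\<exists>j\<in>L. g j < f j)"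
    using sum_strict_mono_ex1[of L g f] assms by fastforce
  then have "\<And>j. j \<in> L \<Longrightarrow> g j = f j" using le by (meson le_neq_implies_less)
  then show ?thesis
    using assms(2,3) unfolding isotone_maps_def by (auto intro: PiE_ext)
qed

text \<open>The colon condition for linear quotients. The premises on \<open>F\<close> say that it
  contains every isotone map above \<open>f\<close> other than \<open>f\<close>, and no map that is
  pointwise at most \<open>f\<close>.\<close>

lemma raising_moves_colon:
  assumes L: "finite L" and inj: "inj_on p L"
    and f: "f \<in> isotone_maps p L e" and F: "F \<subseteq> isotone_maps p L e"
    and not_below: "\<And>g. g \<in> F \<Longrightarrow> \<exists>j\<in>L. f j < g j"
    and above: "\<And>g. g \<in> isotone_maps p L e \<Longrightarrow> (\<And>j. j \<in> L \<Longrightarrow> f j \<le> g j) \<Longrightarrow> g \<noteq> f \<Longrightarrow> g \<in> F"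
  shows "(\<exists>B\<in>graph_of L ` F. B \<subseteq> graph_of L f \<union> K) \<longleftrightarrow> K \<inter> raising_moves p L e f \<noteq> {}"
proof
  assume "\<exists>B\<in>graph_of L ` F. B \<subseteq> graph_of L f \<union> K"
  then obtain g where g: "g \<in> F" and sub: "graph_of L g \<subseteq> graph_of L f \<union> K" by blast
  have giso: "g \<in> isotone_maps p L e" using g F by blast
  \<comment> \<open>Among the places where \<open>g\<close> exceeds \<open>f\<close> a maximal one
    is taken. At every \<open>k\<close> above it, \<open>f k \<ge> g k \<ge> g j\<close>, so raising
    \<open>f\<close> to \<open>g j\<close> there is a move, and this vertex of the graph of
    \<open>g\<close> must come from \<open>K\<close>.\<close>
  define D where "D = {j \<in> L. f j < g j}"
  have "finite (p ` D)" "p ` D \<noteq> {}" using L not_below[OF g] by (auto simp: D_def)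
  then obtain j where j: "j \<in> D" and max: "\<And>k. k \<in> D \<Longrightarrow> p j \<le> p k \<Longrightarrow> p j = p k"
    using finite_has_maximal[of "p ` D"] by blast
  have jL: "j \<in> L" and fg: "f j < g j" using j by (auto simp: D_def)
  obtain r where r: "g j = Suc r" using fg by (cases "g j") auto
  have "Suc r \<le> e" using giso jL r by (auto simp: isotone_maps_def PiE_def Pi_def)
  moreover have "1 \<le> f j" using f jL by (auto simp: isotone_maps_def PiE_def Pi_def)
  moreover have "r < f k" if k: "k \<in> L" "p j < p k" for k
  proof -
    have "k \<notin> D" using max[of k] k(2) by (auto simp: less_le)
    then have "g k \<le> f k" using k by (auto simp: D_def)
    moreover have "g j \<le> g k" using giso k jL by (auto simp: isotone_maps_def)
    ultimately show ?thesis using r by simp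
  qed
  ultimately have "(g j, j) \<in> raising_moves p L e f"
    using jL fg unfolding r raising_moves_iff by auto
  moreover have "(g j, j) \<in> K"
    using sub jL fg by (auto simp: graph_of_def)
  ultimately show "K \<inter> raising_moves p L e f \<noteq> {}" by blast
next
  assume "K \<inter> raising_moves p L e f \<noteq> {}"
  then obtain r j where K: "(Suc r, j) \<in> K" and r: "1 \<le> r" "r < e" and j: "j \<in> L" "f j \<le> r"
    and up: "\<And>k. k \<in> L \<Longrightarrow> p j < p k \<Longrightarrow> r < f k"
    unfolding raising_moves_def by blast
  \<comment> \<open>Raising \<open>f\<close> at \<open>j\<close> alone stays isotone, as all larger
    elements already have value at least \<open>Suc r\<close>; \<open>inj\<close> excludes a second
    label for the same element.\<close>
  let ?g = "f(j := Suc r)"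
  have "?g \<in> L \<rightarrow>\<^sub>E {1..e}"
    using f j r by (auto simp: isotone_maps_def PiE_def Pi_def extensional_def)
  moreover have "?g a \<le> ?g b" if ab: "a \<in> L" "b \<in> L" "p a \<le> p b" for a b
  proof -
    have mono: "f a \<le> f b" using f ab by (auto simp: isotone_maps_def)
    have "r < f b" if "a = j" "b \<noteq> j"
      using that ab inj up[of b] by (auto simp: less_le dest: inj_onD)
    then show ?thesis using mono j by auto
  qed
  ultimately have "?g \<in> isotone_maps p L e" by (simp add: isotone_maps_def)
  moreover have "?g \<noteq> f" using j(2) by (auto dest: fun_cong[where x = j])
  ultimately have "?g \<in> F" using j by (intro above) auto
  moreover have "graph_of L ?g \<subseteq> graph_of L f \<union> K"
    using K by (auto simp: graph_of_def)
  ultimately show "\<exists>B\<in>graph_of L ` F. B \<subseteq> graph_of L f \<union> K" by blast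
qed

text \<open>The statement covers all upward closed families so that it supports the induction: a
  family is obtained by adjoining a minimal map to the rest, and the colon ideal at this map is
  generated by its raising moves.\<close>

lemma linear_resolution_isotone_maps:
  assumes L: "finite L" and inj: "inj_on p L" and F: "F \<subseteq> isotone_maps p L e"
    and up: "\<And>f g. f \<in> F \<Longrightarrow> g \<in> isotone_maps p L e \<Longrightarrow> (\<And>j. j \<in> L \<Longrightarrow> f j \<le> g j) \<Longrightarrow> g \<in> F"
  shows "linear_resolution (card L) (\<lambda>i. \<Sum>f\<in>F. card (raising_moves p L e f) choose i)
    (squarefree_ideal (graph_of L ` F) :: (nat \<times> 'j, 'k::comm_ring_1) mpoly set)"
proof -
  have "finite F" using F finite_isotone_maps[OF L] by (rule finite_subset)
  then show ?thesis using F up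
  proof (induction F rule: finite_psubset_induct)
    case (psubset F)
    show ?case
    proof (cases "F = {}")
      case True
      have "squarefree_ideal {} = {0 :: (nat \<times> 'j, 'k) mpoly}" by (auto simp: squarefree_ideal_def)
      then show ?thesis using True linear_resolution_zero by simp
    next
      case False
      \<comment> \<open>A map with least sum of values is pointwise minimal, so removing it leaves
        an upward closed family.\<close>
      then obtain f where f: "f \<in> F" and least: "\<And>g. g \<in> F \<Longrightarrow> sum f L \<le> sum g L"
        using ex_has_least_nat[of "\<lambda>f. f \<in> F" _ "\<lambda>f. sum f L"] by blast
      let ?F = "F - {f}"
      have fiso: "f \<in> isotone_maps p L e" using f psubset.prems(1) by blast
      have eq: "g = f" if "g \<in> F" "\<And>j. j \<in> L \<Longrightarrow> g j \<le> f j" for g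
        using isotone_maps_eqI[OF L fiso _ that(2) least[OF that(1)]] that(1) psubset.prems(1) by blast
      have "linear_resolution (card L) (\<lambda>i. \<Sum>f\<in>?F. card (raising_moves p L e f) choose i)
          (squarefree_ideal (graph_of L ` ?F) :: (nat \<times> 'j, 'k) mpoly set)"
      proof (rule psubset.IH)
        show "?F \<subset> F" using f by blast
        show "?F \<subseteq> isotone_maps p L e" using psubset.prems(1) by blast
        show "h \<in> ?F" if g: "g \<in> ?F" and h: "h \<in> isotone_maps p L e" and le: "\<And>j. j \<in> L \<Longrightarrow> g j \<le> h j" for g h
          using psubset.prems(2)[of g h] eq[of g] g h le by blast
      qed
      then have IH: "linear_resolution (card (graph_of L f)) (\<lambda>i. \<Sum>f\<in>?F. card (raising_moves p L e f) choose i)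
          (squarefree_ideal (graph_of L ` ?F) :: (nat \<times> 'j, 'k) mpoly set)"
        by (simp only: card_graph_of)
      have colon: "(\<exists>B\<in>graph_of L ` ?F. B \<subseteq> graph_of L f \<union> K) \<longleftrightarrow> K \<inter> raising_moves p L e f \<noteq> {}" for K
      proof (rule raising_moves_colon[OF L inj fiso])
        show "?F \<subseteq> isotone_maps p L e" using psubset.prems(1) by blast
        show "\<exists>j\<in>L. f j < g j" if "g \<in> ?F" for g 
          by (rule ccontr) (use eq[of g] that in \<open>auto simp: not_less\<close>)
        show "g \<in> ?F" if "g \<in> isotone_maps p L e" "\<And>j. j \<in> L \<Longrightarrow> f j \<le> g j" "g \<noteq> f" for g
          using psubset.prems(2)[OF f that(1,2)] that(3) by blast
      qed
      have "linear_resolution (card (graph_of L f))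
          (\<lambda>i. (\<Sum>f\<in>?F. card (raising_moves p L e f) choose i) + (card (raising_moves p L e f) choose i))
          (squarefree_ideal (insert (graph_of L f) (graph_of L ` ?F)) :: (nat \<times> 'j, 'k) mpoly set)"
        by (rule linear_resolution_linear_quotient[OF IH finite_graph_of[OF L] finite_raising_moves[OF L] colon])
      moreover have "insert (graph_of L f) (graph_of L ` ?F) = graph_of L ` F" using f by blast
      moreover have "(\<Sum>f\<in>?F. card (raising_moves p L e f) choose i) + (card (raising_moves p L e f) choose i) =
          (\<Sum>f\<in>F. card (raising_moves p L e f) choose i)" for i
        using psubset.hyps f by (simp add: sum.remove)
      ultimately show ?thesis by (simp only: card_graph_of)
    qed
  qed
qed

section \<open>Vertex covers of the multichain clutter\<close>

text \<open>The fixed point is the least \<open>r\<close> with \<open>f (j r) \<le> r\<close>. If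
  \<open>r > 1\<close>, the value just before exceeds its index, and monotonicity gives
  \<open>r \<le> f (j r)\<close>; if \<open>r = 1\<close>, all values are at least 1.\<close>

lemma isotone_map_graph_meets_multichain:
  assumes f: "f \<in> isotone_maps p (labels p n Q) e" and j: "multichain p n Q e j" and e: "1 \<le> e"
  shows "\<exists>r\<in>{1..e}. f (j r) = r"
proof -
  have range: "1 \<le> f (j r)" "f (j r) \<le> e" if "r \<in> {1..e}" for r
    using f j that by (fastforce simp: isotone_maps_def multichain_def PiE_def Pi_def)+
  define r where "r = (LEAST r. 1 \<le> r \<and> f (j r) \<le> r)"
  have ex: "1 \<le> e \<and> f (j e) \<le> e" using range[of e] e by simp
  then have r: "1 \<le> r \<and> f (j r) \<le> r" and re: "r \<le> e"
    unfolding r_def by (rule LeastI, rule Least_le)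
  have "r \<le> f (j r)"
  proof (cases "r = 1")
    case True
    then show ?thesis using range[of r] e by simp
  next
    case False
    then obtain s where s: "r = Suc s" "1 \<le> s" using r by (cases r) auto
    then have "\<not> f (j s) \<le> s"
      using not_less_Least[of s "\<lambda>r. 1 \<le> r \<and> f (j r) \<le> r"] unfolding r_def[symmetric] by auto
    moreover have "f (j s) \<le> f (j (Suc s))"
      using f j s re unfolding isotone_maps_def multichain_def by simp
    ultimately show ?thesis using s by simp
  qed
  then show ?thesis using r re by (intro bexI[of _ r]) auto
qed

text \<open>The value at \<open>q\<close> is one more than the length of the longest multichain below \<open>q\<close> that
  avoids the cover; by maximality this vertex over \<open>q\<close> lies in the cover.\<close>

lemma vertex_cover_contains_graph:
  assumes W: "vertex_cover (clutter_vertices p n Q e) (clutter_edges p n Q e) W" and e: "1 \<le> e"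
  shows "\<exists>f\<in>isotone_maps p (labels p n Q) e. graph_of (labels p n Q) f \<subseteq> W"
proof -
  let ?L = "labels p n Q"
  \<comment> \<open>\<open>T q\<close> holds the lengths of multichains below \<open>p q\<close>
    whose vertices all avoid \<open>W\<close>. Length 0 belongs to it, so the maximum exists and the
    values start at 1; the guard \<open>0 < t\<close> is for that empty chain.\<close>
  define T where "T q = {t. \<exists>c. (\<forall>r\<in>{1..t}. c r \<in> ?L \<and> (r, c r) \<notin> W) \<and>
    (\<forall>r\<in>{1..<t}. p (c r) \<le> p (c (Suc r))) \<and> (0 < t \<longrightarrow> p (c t) \<le> p q)}" for q
  have T0: "0 \<in> T q" for q by (simp add: T_def)
  \<comment> \<open>The first \<open>e\<close> members of a longer chain would form an edge that
    \<open>W\<close> misses.\<close>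
  have Te: "t < e" if t: "t \<in> T q" for t q
  proof (rule ccontr)
    assume "\<not> t < e"
    then have et: "e \<le> t" by simp
    obtain c where c: "\<forall>r\<in>{1..t}. c r \<in> ?L \<and> (r, c r) \<notin> W" "\<forall>r\<in>{1..<t}. p (c r) \<le> p (c (Suc r))"
      using t unfolding T_def by blast
    have "multichain p n Q e c" using c et unfolding multichain_def by auto
    then have "(\<lambda>r. (r, c r)) ` {1..e} \<in> clutter_edges p n Q e" unfolding clutter_edges_def by blast
    then have "W \<inter> (\<lambda>r. (r, c r)) ` {1..e} \<noteq> {}" using W unfolding vertex_cover_def by blast
    then show False using c(1) et by auto
  qed
  have finT: "finite (T q)" for q by (rule finite_subset[of _ "{..<e}"]) (auto dest: Te)
  have Tmono: "T a \<subseteq> T b" if "p a \<le> p b" for a b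
    using that unfolding T_def by (blast intro: order_trans)
  define f where "f = (\<lambda>q\<in>?L. Suc (Max (T q)))"
  have "f \<in> isotone_maps p ?L e"
  proof -
    have "Suc (Max (T q)) \<le> e" for q using Te[OF Max_in[OF finT]] T0 by (intro Suc_leI) blast
    moreover have "Max (T a) \<le> Max (T b)" if "p a \<le> p b" for a b
      using Max_mono[OF Tmono[OF that] _ finT] T0 by blast
    ultimately show ?thesis by (auto simp: isotone_maps_def f_def)
  qed
  moreover have "graph_of ?L f \<subseteq> W"
  proof (clarsimp simp: graph_of_def f_def)
    fix q assume q: "q \<in> ?L"
    obtain t where t: "Max (T q) = t" by blast
    show "(Suc (Max (T q)), q) \<in> W"
      unfolding t
    proof (rule ccontr)
      assume nW: "(Suc t, q) \<notin> W"
      have "t \<in> T q" using Max_in[OF finT] T0 unfolding t[symmetric] by blast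
      then obtain c where c: "\<forall>r\<in>{1..t}. c r \<in> ?L \<and> (r, c r) \<notin> W"
        "\<forall>r\<in>{1..<t}. p (c r) \<le> p (c (Suc r))" "0 < t \<longrightarrow> p (c t) \<le> p q"
        unfolding T_def by blast
      let ?c = "c(Suc t := q)"
      have "\<forall>r\<in>{1..Suc t}. ?c r \<in> ?L \<and> (r, ?c r) \<notin> W" using c(1) q nW by auto
      moreover have "\<forall>r\<in>{1..<Suc t}. p (?c r) \<le> p (?c (Suc r))"
      proof
        fix r assume r: "r \<in> {1..<Suc t}"
        show "p (?c r) \<le> p (?c (Suc r))"
          using r c(2,3) by (cases "r = t") auto
      qed
      ultimately have "Suc t \<in> T q" unfolding T_def by (intro CollectI exI[of _ ?c]) simp
      then have "Suc t \<le> t" unfolding t[symmetric] by (rule Max_ge[OF finT])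
      then show False by simp
    qed
  qed
  ultimately show ?thesis by blast
qed

lemma squarefree_ideal_cong:
  assumes "\<And>A. A \<in> \<W> \<Longrightarrow> \<exists>B\<in>\<W>'. B \<subseteq> A" "\<And>A. A \<in> \<W>' \<Longrightarrow> \<exists>B\<in>\<W>. B \<subseteq> A"
  shows "squarefree_ideal \<W> = squarefree_ideal \<W>'"
proof -
  have "(\<exists>A\<in>\<W>. A \<subseteq> M) \<longleftrightarrow> (\<exists>A\<in>\<W>'. A \<subseteq> M)" for M using assms by (meson subset_trans)
  then show ?thesis by (simp add: squarefree_ideal_def)
qed

text \<open>Graphs of isotone maps are vertex covers, and every vertex cover contains such a graph,
  so both families of sets generate the same ideal.\<close>

lemma multichain_cover_ideal_squarefree:
  assumes e: "1 \<le> e"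
  shows "multichain_cover_ideal p n Q e = squarefree_ideal (graph_of (labels p n Q) ` isotone_maps p (labels p n Q) e)"
proof -
  let ?L = "labels p n Q" and ?V = "clutter_vertices p n Q e" and ?E = "clutter_edges p n Q e"
  have finV: "finite ?V" by (simp add: clutter_vertices_def labels_def)
  have "multichain_cover_ideal p n Q e = ideal_gen {\<Prod>x\<in>W. var x | W. W \<in> {W. vertex_cover ?V ?E W}}"
    unfolding multichain_cover_ideal_def cover_ideal_def by simp
  also have "\<dots> = squarefree_ideal {W. vertex_cover ?V ?E W}"
    by (rule ideal_gen_squarefree) (auto simp: vertex_cover_def intro: finite_subset[OF _ finV])
  also have "\<dots> = squarefree_ideal (graph_of ?L ` isotone_maps p ?L e)"
  proof (rule squarefree_ideal_cong)
    fix W assume "W \<in> {W. vertex_cover ?V ?E W}"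
    then have "vertex_cover ?V ?E W" by simp
    from vertex_cover_contains_graph[OF this e]
    show "\<exists>B\<in>graph_of ?L ` isotone_maps p ?L e. B \<subseteq> W" by simp
  next
    fix B assume "B \<in> graph_of ?L ` isotone_maps p ?L e"
    then obtain f where f: "f \<in> isotone_maps p ?L e" and B: "B = graph_of ?L f" by blast
    have "B \<subseteq> ?V" using f unfolding B graph_of_def clutter_vertices_def
      by (auto simp: isotone_maps_def PiE_def Pi_def)
    moreover have "B \<inter> A \<noteq> {}" if A: "A \<in> ?E" for A
    proof -
      obtain j where j: "multichain p n Q e j" and Aj: "A = (\<lambda>r. (r, j r)) ` {1..e}"
        using A unfolding clutter_edges_def by blast
      obtain r where r: "r \<in> {1..e}" "f (j r) = r"
        using isotone_map_graph_meets_multichain[OF f j e] by blast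
      have "j r \<in> ?L" using j r(1) by (simp add: multichain_def)
      then have "(f (j r), j r) \<in> B" unfolding B graph_of_def by blast
      then have "(r, j r) \<in> B" using r(2) by simp
      then show ?thesis unfolding Aj using r(1) by blast
    qed
    ultimately have "vertex_cover ?V ?E B" by (simp add: vertex_cover_def)
    then show "\<exists>A\<in>{W. vertex_cover ?V ?E W}. A \<subseteq> B" by blast
  qed
  finally show ?thesis .
qed

text \<open>The linear resolution for the family of all isotone maps. For \<open>Q = {}\<close>
  there is a single isotone map with no raising moves, in accordance with the unit ideal.\<close>

lemma betti_multichain_cover_ideal:
  assumes inj: "inj_on p {1..n}" and e: "1 \<le> e"
  shows "betti (multichain_cover_ideal p n Q e :: (nat \<times> nat, 'k::field) mpoly set) i =
    (if i < 0 then 0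
     else \<Sum>f\<in>isotone_maps p (labels p n Q) e. card (raising_moves p (labels p n Q) e f) choose nat i)"
proof -
  let ?L = "labels p n Q"
  have "finite ?L" "inj_on p ?L" using inj by (auto simp: labels_def intro: inj_on_subset)
  then have "linear_resolution (card ?L) (\<lambda>i. \<Sum>f\<in>isotone_maps p ?L e. card (raising_moves p ?L e f) choose i)
      (multichain_cover_ideal p n Q e :: (nat \<times> nat, 'k) mpoly set)"
    unfolding multichain_cover_ideal_squarefree[OF e] by (intro linear_resolution_isotone_maps) auto
  then show ?thesis by (rule betti_linear_resolution)
qed

section \<open>Splitting off the top value of an isotone map\<close>

text \<open>Moves to the top value \<open>Suc e\<close> take place at the maximal elements of
  \<open>D\<close>. The others have thresholds \<open>r < e\<close>, for which labels outside
  \<open>D\<close> impose nothing, since \<open>f\<close> already exceeds \<open>e\<close> on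
  them.\<close>

lemma card_raising_moves_Suc:
  assumes L: "finite L" and e: "1 \<le> e" and D: "D = {j \<in> L. f j \<le> e}"
    and g: "\<And>j. j \<in> D \<Longrightarrow> g j = f j"
  shows "card (raising_moves p L (Suc e) f) =
    card {j \<in> D. \<forall>k\<in>D. \<not> p j < p k} + card (raising_moves p D e g)"
proof -
  let ?M = "{j \<in> D. \<forall>k\<in>D. \<not> p j < p k}"
  have "raising_moves p L (Suc e) f = Pair (Suc e) ` ?M \<union> raising_moves p D e g"
  proof (intro equalityI subsetI)
    fix x assume "x \<in> raising_moves p L (Suc e) f"
    then obtain r j where x: "x = (Suc r, j)" and r: "1 \<le> r" "r \<le> e" and j: "j \<in> L" "f j \<le> r"
      and up: "\<And>k. k \<in> L \<Longrightarrow> p j < p k \<Longrightarrow> r < f k"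
      unfolding raising_moves_def by auto
    show "x \<in> Pair (Suc e) ` ?M \<union> raising_moves p D e g"
    proof (cases "r = e")
      case True
      then have "j \<in> ?M" using j up by (fastforce simp: D)
      then show ?thesis using True x by blast
    next
      case False
      then have "j \<in> D" "r < e" using j r by (auto simp: D)
      moreover have "\<forall>k\<in>D. p j < p k \<longrightarrow> r < g k" using up g by (auto simp: D)
      ultimately show ?thesis using x r(1) j(2) g by (simp add: raising_moves_iff)
    qed
  next
    fix x assume "x \<in> Pair (Suc e) ` ?M \<union> raising_moves p D e g"
    then consider j where "x = (Suc e, j)" "j \<in> ?M"
      | r j where "x = (Suc r, j)" "1 \<le> r" "r < e" "j \<in> D" "g j \<le> r" "\<And>k. k \<in> D \<Longrightarrow> p j < p k \<Longrightarrow> r < g k"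
      unfolding raising_moves_def by blast
    then show "x \<in> raising_moves p L (Suc e) f"
    proof cases
      case 1
      then have "\<forall>k\<in>L. p j < p k \<longrightarrow> e < f k" by (auto simp: D not_le)
      moreover have "j \<in> L" "f j \<le> e" using 1(2) by (simp_all add: D)
      ultimately show ?thesis using 1(1) e by (simp add: raising_moves_iff)
    next
      case 2
      have "r < f k" if "k \<in> L" "p j < p k" for k
        using 2(3) 2(6)[of k] that g[of k] by (cases "k \<in> D") (auto simp: D)
      moreover have "j \<in> L" "f j \<le> r" using 2(4,5) g[of j] by (simp_all add: D)
      ultimately show ?thesis using 2(1,2,3) by (simp add: raising_moves_iff)
    qed
  qed
  moreover have "Pair (Suc e) ` ?M \<inter> raising_moves p D e g = {}"
    unfolding raising_moves_def by auto
  moreover have "finite D" using L by (simp add: D)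
  moreover have "card (Pair (Suc e) ` ?M) = card ?M" by (rule card_image) (auto intro: inj_onI)
  ultimately show ?thesis
    by (simp add: card_Un_disjoint finite_raising_moves)
qed

text \<open>Vandermonde's identity over another range: terms with \<open>h > m\<close> vanish by the
  binomial and terms with \<open>h > i\<close> by the guard, which mirrors the vanishing of Betti
  numbers in negative degrees.\<close>

lemma vandermonde_bounded:
  "(\<Sum>h = 0..m. (m choose h) * (if h \<le> i then s choose (i - h) else 0)) = (m + s) choose i"
proof -
  have "(m + s) choose i = (\<Sum>h\<in>{..i}. (m choose h) * (s choose (i - h)))"
    by (rule vandermonde[symmetric])
  also have "\<dots> = (\<Sum>h\<in>{0..m} \<inter> {..i}. (m choose h) * (s choose (i - h)))"
    by (rule sum.mono_neutral_right) (auto simp: binomial_eq_0)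
  also have "\<dots> = (\<Sum>h = 0..m. (m choose h) * (if h \<le> i then s choose (i - h) else 0))"
    by (rule sum.mono_neutral_cong_left) auto
  finally show ?thesis by simp
qed

lemma card_max_elements_labels:
  assumes "bij_betw p {1..n} P" "\<alpha> \<subseteq> P"
  shows "card (max_elements \<alpha>) = card {j \<in> labels p n \<alpha>. \<forall>k\<in>labels p n \<alpha>. \<not> p j < p k}"
proof -
  have img: "p ` labels p n \<alpha> = \<alpha>"
    using assms unfolding labels_def bij_betw_def by auto
  have "max_elements \<alpha> = p ` {j \<in> labels p n \<alpha>. \<forall>k\<in>labels p n \<alpha>. \<not> p j < p k}"
    unfolding max_elements_def by (subst (1 2) img[symmetric]) auto
  moreover have "inj_on p {j \<in> labels p n \<alpha>. \<forall>k\<in>labels p n \<alpha>. \<not> p j < p k}"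
    using assms(1) unfolding bij_betw_def labels_def by (auto intro: inj_on_subset)
  ultimately show ?thesis by (simp add: card_image)
qed

text \<open>An isotone map into \<open>{1..Suc e}\<close> is determined by the poset ideal on which
  it is at most \<open>e\<close> and by its restriction to that ideal; the number of raising moves
  splits accordingly.\<close>

lemma sum_isotone_maps_Suc:
  assumes bij: "bij_betw p {1..n} P" and fin: "finite P" and e: "1 \<le> e"
  shows "(\<Sum>f\<in>isotone_maps p (labels p n P) (Suc e). card (raising_moves p (labels p n P) (Suc e) f) choose i) =
    (\<Sum>\<alpha>\<in>poset_ideals P. \<Sum>g\<in>isotone_maps p (labels p n \<alpha>) e.
      (card (max_elements \<alpha>) + card (raising_moves p (labels p n \<alpha>) e g)) choose i)"
proof -
  let ?L = "labels p n"
  have inj: "inj_on p {1..n}" and img: "p ` {1..n} = P" using bij by (auto simp: bij_betw_def)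
  have LP: "?L P = {1..n}" using img by (auto simp: labels_def)
  have finL: "finite (?L \<alpha>)" for \<alpha> by (simp add: labels_def)
  have Limg: "?L (p ` D) = D" if "D \<subseteq> {1..n}" for D
    using that inj unfolding labels_def by (auto dest: inj_onD)
  have imgL: "p ` ?L \<alpha> = \<alpha>" if "\<alpha> \<subseteq> P" for \<alpha> using that img unfolding labels_def by auto
  have finI: "finite (poset_ideals P)"
    by (rule finite_subset[of _ "Pow P"]) (use fin in \<open>auto simp: poset_ideals_def\<close>)
  let ?S = "SIGMA \<alpha>:poset_ideals P. isotone_maps p (?L \<alpha>) e"
  let ?low = "\<lambda>f. {j \<in> {1..n}. f j \<le> e}"
  \<comment> \<open>The inverse assigns the top value \<open>Suc e\<close> outside the ideal, and
    stays \<open>undefined\<close> outside \<open>{1..n}\<close> as extensionality demands.\<close>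
  let ?ext = "\<lambda>(\<alpha>, g). \<lambda>j\<in>{1..n}. if j \<in> ?L \<alpha> then g j else Suc e"
  have "(\<Sum>f\<in>isotone_maps p {1..n} (Suc e). card (raising_moves p {1..n} (Suc e) f) choose i) =
    (\<Sum>(\<alpha>, g)\<in>?S. (card (max_elements \<alpha>) + card (raising_moves p (?L \<alpha>) e g)) choose i)"
  proof (rule sum.reindex_bij_witness[where i = ?ext and j = "\<lambda>f. (p ` ?low f, restrict f (?low f))"])
    fix f assume f: "f \<in> isotone_maps p {1..n} (Suc e)"
    have lab: "?L (p ` ?low f) = ?low f" by (rule Limg) auto
    have range: "1 \<le> f j \<and> f j \<le> Suc e" if "j \<in> {1..n}" for j
      using f that by (auto simp: isotone_maps_def PiE_def Pi_def)
    have ext: "f j = undefined" if "j \<notin> {1..n}" for j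
      using f that by (auto simp: isotone_maps_def PiE_def extensional_def)
    have mono: "f a \<le> f b" if "a \<in> {1..n}" "b \<in> {1..n}" "p a \<le> p b" for a b
      using f that by (auto simp: isotone_maps_def)
    show "?ext (p ` ?low f, restrict f (?low f)) = f"
    proof
      fix j
      show "?ext (p ` ?low f, restrict f (?low f)) j = f j"
        unfolding lab split_conv restrict_def using range[of j] ext[of j] by auto
    qed
    have "p ` ?low f \<in> poset_ideals P"
      unfolding poset_ideals_def
    proof (intro CollectI conjI ballI impI)
      show "p ` ?low f \<subseteq> P" using img by auto
      fix a q assume "a \<in> p ` ?low f" "q \<in> P" "q \<le> a"
      then obtain j k where "j \<in> ?low f" "a = p j" "k \<in> {1..n}" "q = p k" using img by blast
      then show "q \<in> p ` ?low f" using mono[of k j] \<open>q \<le> a\<close> by fastforce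
    qed
    moreover have "restrict f (?low f) \<in> isotone_maps p (?low f) e"
      unfolding isotone_maps_def using range mono by auto
    ultimately show "(p ` ?low f, restrict f (?low f)) \<in> ?S"
      unfolding mem_Sigma_iff lab by blast
    have "card (raising_moves p {1..n} (Suc e) f) = card {j \<in> ?low f. \<forall>k\<in>?low f. \<not> p j < p k} +
        card (raising_moves p (?low f) e (restrict f (?low f)))"
      by (rule card_raising_moves_Suc[OF _ e]) auto
    moreover have "card (max_elements (p ` ?low f)) = card {j \<in> ?low f. \<forall>k\<in>?low f. \<not> p j < p k}"
      using card_max_elements_labels[OF bij, of "p ` ?low f"] img unfolding lab by blast
    ultimately show "(case (p ` ?low f, restrict f (?low f)) of (\<alpha>, g) \<Rightarrow>
        (card (max_elements \<alpha>) + card (raising_moves p (?L \<alpha>) e g)) choose i) =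
        card (raising_moves p {1..n} (Suc e) f) choose i"
      by (simp only: lab split_conv)
  next
    fix x assume x: "x \<in> ?S"
    obtain \<alpha> g where xag: "x = (\<alpha>, g)" by (cases x)
    have \<alpha>: "\<alpha> \<in> poset_ideals P" and g: "g \<in> isotone_maps p (?L \<alpha>) e" using x xag by auto
    have \<alpha>P: "\<alpha> \<subseteq> P" and down: "\<And>a q. a \<in> \<alpha> \<Longrightarrow> q \<in> P \<Longrightarrow> q \<le> a \<Longrightarrow> q \<in> \<alpha>"
      using \<alpha> by (auto simp: poset_ideals_def)
    have grange: "1 \<le> g j \<and> g j \<le> e" if "j \<in> ?L \<alpha>" for j
      using g that by (auto simp: isotone_maps_def PiE_def Pi_def)
    have Lsub: "?L \<alpha> \<subseteq> {1..n}" by (auto simp: labels_def)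
    have low: "?low (?ext x) = ?L \<alpha>"
      using grange Lsub by (auto simp: xag)
    have "restrict (?ext x) (?L \<alpha>) = g"
    proof
      fix j
      show "restrict (?ext x) (?L \<alpha>) j = g j"
        using g Lsub[THEN subsetD, of j] by (cases "j \<in> ?L \<alpha>") (auto simp: xag isotone_maps_def PiE_def extensional_def)
    qed
    then show "(p ` ?low (?ext x), restrict (?ext x) (?low (?ext x))) = x"
      unfolding low using imgL[OF \<alpha>P] by (simp add: xag)
    \<comment> \<open>If the larger element lies in the ideal, so does the smaller one, by closure
      downwards; otherwise the larger one has the top value.\<close>
    have "?ext x a \<le> ?ext x b" if ab: "a \<in> {1..n}" "b \<in> {1..n}" "p a \<le> p b" for a b
    proof (cases "b \<in> ?L \<alpha>")
      case True
      then have "a \<in> ?L \<alpha>" using down[of "p b" "p a"] ab img by (auto simp: labels_def)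
      then show ?thesis using True ab g by (auto simp: xag isotone_maps_def)
    next
      case False
      then show ?thesis using ab grange[of a] by (auto simp: xag)
    qed
    moreover have "?ext x \<in> {1..n} \<rightarrow>\<^sub>E {1..Suc e}"
      using grange by (fastforce simp: xag)
    ultimately show "?ext x \<in> isotone_maps p {1..n} (Suc e)"
      unfolding isotone_maps_def by blast
  qed
  also have "\<dots> = (\<Sum>\<alpha>\<in>poset_ideals P. \<Sum>g\<in>isotone_maps p (?L \<alpha>) e.
      (card (max_elements \<alpha>) + card (raising_moves p (?L \<alpha>) e g)) choose i)"
    using finI finite_isotone_maps[OF finL] by (intro sum.Sigma[symmetric]) auto
  finally show ?thesis unfolding LP .
qed

section \<open>The recursion for the Betti numbers\<close>

theorem theorem3p1:
  fixes P :: "'a::order set" and p :: "nat \<Rightarrow> 'a" and n d i :: nat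
  assumes "finite P" and "P \<noteq> {}"
    and "bij_betw p {1..n} P"
    and "\<forall>a\<in>{1..n}. \<forall>b\<in>{1..n}. p a < p b \<longrightarrow> a < b"
    and "d \<ge> 2"
  shows "betti (multichain_cover_ideal p n P d :: (nat \<times> nat, 'k::field) mpoly set) (int i) =
    (\<Sum>\<alpha>\<in>poset_ideals P. \<Sum>h=0..card (max_elements \<alpha>).
       (card (max_elements \<alpha>) choose h) *
       betti (multichain_cover_ideal p n \<alpha> (d - 1) :: (nat \<times> nat, 'k) mpoly set) (int i - int h))"
proof -
  obtain e where d: "d = Suc e" and e: "1 \<le> e" using assms(5) by (cases d) auto
  have inj: "inj_on p {1..n}" using assms(3) by (simp add: bij_betw_def)
  let ?iso = "\<lambda>\<alpha>. isotone_maps p (labels p n \<alpha>) e"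
  let ?s = "\<lambda>\<alpha> g. card (raising_moves p (labels p n \<alpha>) e g)"
  \<comment> \<open>For each poset ideal the sums over \<open>h\<close> and \<open>g\<close> are
    exchanged, and Vandermonde's identity is applied to every \<open>g\<close> separately.\<close>
  have "(\<Sum>h=0..m. (m choose h) * betti (multichain_cover_ideal p n \<alpha> e :: (nat \<times> nat, 'k) mpoly set) (int i - int h)) =
      (\<Sum>g\<in>?iso \<alpha>. (m + ?s \<alpha> g) choose i)" for \<alpha> m
  proof -
    \<comment> \<open>The index \<open>int i - int h\<close> is negative exactly for
      \<open>h > i\<close>, where \<open>betti\<close> and the guarded summands are both 0.\<close>
    have "betti (multichain_cover_ideal p n \<alpha> e :: (nat \<times> nat, 'k) mpoly set) (int i - int h) =
        (\<Sum>g\<in>?iso \<alpha>. if h \<le> i then ?s \<alpha> g choose (i - h) else 0)" for h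
      unfolding betti_multichain_cover_ideal[OF inj e] by (auto simp: nat_diff_distrib)
    then have "(\<Sum>h=0..m. (m choose h) * betti (multichain_cover_ideal p n \<alpha> e :: (nat \<times> nat, 'k) mpoly set) (int i - int h)) =
        (\<Sum>h=0..m. \<Sum>g\<in>?iso \<alpha>. (m choose h) * (if h \<le> i then ?s \<alpha> g choose (i - h) else 0))"
      by (simp only: sum_distrib_left)
    also have "\<dots> = (\<Sum>g\<in>?iso \<alpha>. \<Sum>h=0..m. (m choose h) * (if h \<le> i then ?s \<alpha> g choose (i - h) else 0))"
      by (rule sum.swap)
    finally show ?thesis by (simp only: vandermonde_bounded)
  qed
  moreover have "betti (multichain_cover_ideal p n P d :: (nat \<times> nat, 'k) mpoly set) (int i) =
      (\<Sum>\<alpha>\<in>poset_ideals P. \<Sum>g\<in>?iso \<alpha>. (card (max_elements \<alpha>) + ?s \<alpha> g) choose i)"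
    unfolding d using betti_multichain_cover_ideal[OF inj, of "Suc e" P "int i"] sum_isotone_maps_Suc[OF assms(3,1) e]
    by simp
  ultimately show ?thesis by (simp add: d)
qed

end
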